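(* There exists a deterministic online bipartite edge-coloring algorithm under one-sided node arrivals which, for bipartite graphs whose maximum degree $\Delta$ is known in advance and satisfies $\Delta=\omega(\log n)$, is $\big(\frac{e}{e-1}+o(1)\big)$-competitive.
   Context: Online bipartite edge coloring under one-sided node arrivals: the input is a bipartite graph with $n$ offline nodes on one side, known up front, and $n$ online nodes $v_1,\dots,v_n$ on the other side. At time $t=1,\dots,n$ the online node $v_t$ is revealed together with all its edges (to its neighbors $N(v_t)$ among the offline nodes). The maximum degree $\Delta$ of the graph is known to the algorithm in advance. On arrival of each edge the algorithm must immediately and irrevocably assign it a color, such that no two edges sharing an endpoint receive the same color. A (deterministic) algorithm is $\alpha$-competitive if on every such input of maximum degree $\Delta$ it uses at most $\alpha\Delta$ colors. Asymptotic notation ($o(1)$, $\omega(\log n)$) is as $n\to\infty$. *)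

theory Defs
  imports Complex_Main "HOL-Library.Landau_Symbols"
begin

text \<open>
  The offline nodes are \<open>0, \<dots>, n - 1\<close>. An arrival sequence is a list \<open>N\<close> of length \<open>n\<close> whose
  \<open>t\<close>-th entry (counting from 0) is the neighbourhood of the \<open>t\<close>-th arriving online node.
  An edge is a pair \<open>(u, t)\<close> of an offline node and an online node.
\<close>

type_synonym arrivals = "nat set list"

definition edges :: "arrivals \<Rightarrow> (nat \<times> nat) set" where
  "edges N = {(u, t). t < length N \<and> u \<in> N ! t}"

definition offline_degree :: "arrivals \<Rightarrow> nat \<Rightarrow> nat" where
  "offline_degree N u = card {e \<in> edges N. fst e = u}"

definition online_degree :: "arrivals \<Rightarrow> nat \<Rightarrow> nat" where
  "online_degree N t = card {e \<in> edges N. snd e = t}"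

text \<open>The inserted 0 only matters for the graph without nodes.\<close>

definition max_degree :: "nat \<Rightarrow> arrivals \<Rightarrow> nat" where
  "max_degree n N = Max (insert 0 (offline_degree N ` {..<n} \<union> online_degree N ` {..<n}))"

definition inputs :: "nat \<Rightarrow> nat \<Rightarrow> arrivals set" where
  "inputs n \<Delta> = {N. length N = n \<and> (\<forall>S \<in> set N. S \<subseteq> {..<n}) \<and> max_degree n N = \<Delta>}"

definition proper_edge_coloring :: "(nat \<times> nat) set \<Rightarrow> (nat \<times> nat \<Rightarrow> nat) \<Rightarrow> bool" where
  "proper_edge_coloring E c \<longleftrightarrow>
     (\<forall>e \<in> E. \<forall>f \<in> E. e \<noteq> f \<and> (fst e = fst f \<or> snd e = snd f) \<longrightarrow> c e \<noteq> c f)"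

text \<open>
  A deterministic online algorithm receives \<open>n\<close>, \<open>\<Delta>\<close> and the neighbourhoods revealed so far
  (the last one being that of the node just arrived), and returns the color of the edge from
  the node just arrived to each of its neighbours \<open>u\<close>. Its earlier color choices
  are functions of the same data, so they need not be passed as an argument.
\<close>

type_synonym online_algorithm = "nat \<Rightarrow> nat \<Rightarrow> arrivals \<Rightarrow> nat \<Rightarrow> nat"

definition coloring_of :: "online_algorithm \<Rightarrow> nat \<Rightarrow> nat \<Rightarrow> arrivals \<Rightarrow> nat \<times> nat \<Rightarrow> nat" where
  "coloring_of A n \<Delta> N = (\<lambda>(u, t). A n \<Delta> (take (Suc t) N) u)"

definition online_edge_coloring_algorithm :: "online_algorithm \<Rightarrow> bool" where
  "online_edge_coloring_algorithm A \<longleftrightarrow>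
     (\<forall>n \<Delta>. \<forall>N \<in> inputs n \<Delta>. proper_edge_coloring (edges N) (coloring_of A n \<Delta> N))"

definition competitive :: "real \<Rightarrow> online_algorithm \<Rightarrow> nat \<Rightarrow> nat \<Rightarrow> bool" where
  "competitive \<alpha> A n \<Delta> \<longleftrightarrow>
     (\<forall>N \<in> inputs n \<Delta>. real (card (coloring_of A n \<Delta> N ` edges N)) \<le> \<alpha> * real \<Delta>)"

end

theory Submission imports Defs begin

text \<open>
  In fact \<open>3 \<Delta> / 2\<close> colors suffice once \<open>\<Delta> \<ge> C (1 + ln n)\<close>, and \<open>3 / 2 \<le> e / (e - 1)\<close>.

  Every offline node \<open>u\<close> carries weights \<open>M u c\<close> on about \<open>5 \<Delta> / 4\<close> main colors \<open>c\<close>, initially 1, and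
  an arriving edge at \<open>u\<close> wants color \<open>c\<close> with probability \<open>M u c / K\<close>. A taken color gets weight 0,
  the others are rescaled so that each weight is a martingale. As adjacent edges never take the same
  color, the overlaps \<open>\<Sum>c. M u c * M v c\<close> are supermartingales, whatever the joint law of the
  choices. While all overlaps are at most \<open>(1 + \<delta>)\<close> times their initial value, a second moment
  argument shows that only few colors are demanded by the neighbours of the arriving node with
  total probability above 1. These overloaded colors are skipped, so that the demands form a
  fractional matching, and the few edges that get nothing are colored greedily from a small
  extra palette.

  An exponential potential over the \<open>O(n\<^sup>2)\<close> overlaps, total weights and numbers of wasted edges
  keeps them all near their means, as \<open>\<Delta>\<close> is a large multiple of \<open>ln n\<close>. To first order it is
  linear in the matching, so by Birkhoff's theorem some integral matching does not increase it;
  choosing such a matching makes the algorithm deterministic.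
\<close>

section \<open>Rounding fractional matchings\<close>

text \<open>Induction on the number of indices. If a proper nonempty \<open>J\<close> is tight, it
  is matched first and the rest avoids its union \<open>T\<close>. Otherwise every nonempty proper
  subfamily has an element to spare, so any index may take any of its elements.\<close>

lemma Hall_marriage:
  fixes A :: "'i \<Rightarrow> 'c set"
  assumes "finite I" "\<And>i. i \<in> I \<Longrightarrow> finite (A i)"
    and "\<And>J. J \<subseteq> I \<Longrightarrow> card J \<le> card (\<Union>i\<in>J. A i)"
  shows "\<exists>f. inj_on f I \<and> (\<forall>i\<in>I. f i \<in> A i)"
  using assms
proof (induction "card I" arbitrary: I A rule: less_induct)
  case less
  note fin = \<open>finite I\<close> and finA = less.prems(2) and hall = less.prems(3)
  show ?case
  proof (cases "\<exists>J. J \<subseteq> I \<and> J \<noteq> {} \<and> J \<noteq> I \<and> card J = card (\<Union>i\<in>J. A i)")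
    case True
    then obtain J where J: "J \<subseteq> I" "J \<noteq> {}" "J \<noteq> I" "card J = card (\<Union>i\<in>J. A i)" by blast
    define T where "T = (\<Union>i\<in>J. A i)"
    have finJ: "finite J" using J(1) fin finite_subset by blast
    have finT: "finite T" unfolding T_def using finJ finA J(1) by blast
    have "card J < card I" using J(1,3) fin by (intro psubset_card_mono) auto
    moreover have "finite (A i)" if "i \<in> J" for i using finA J(1) that by blast
    moreover have "card L \<le> card (\<Union>i\<in>L. A i)" if "L \<subseteq> J" for L using hall J(1) that by simp
    ultimately obtain f where f: "inj_on f J" "\<forall>i\<in>J. f i \<in> A i"
      using less.hyps[OF _ finJ, of A] by blast
    have cJ: "card (I - J) < card I" using J(1,2) fin by (intro psubset_card_mono) auto
    have "\<exists>g. inj_on g (I - J) \<and> (\<forall>i\<in>I - J. g i \<in> A i - T)"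
    proof (rule less.hyps[OF cJ])
      show "finite (I - J)" using fin by simp
      show "finite (A i - T)" if "i \<in> I - J" for i using finA that by simp
      fix L assume L: "L \<subseteq> I - J"
      have finL: "finite L" using L fin finite_subset by blast
      have "card J + card L = card (J \<union> L)"
        using L finJ finL by (subst card_Un_disjoint) auto
      also have "\<dots> \<le> card (\<Union>i\<in>J \<union> L. A i)" using L J(1) by (intro hall) auto
      also have "(\<Union>i\<in>J \<union> L. A i) = T \<union> (\<Union>i\<in>L. A i - T)" by (auto simp: T_def)
      also have "card \<dots> \<le> card T + card (\<Union>i\<in>L. A i - T)" by (rule card_Un_le)
      finally show "card L \<le> card (\<Union>i\<in>L. A i - T)" using J(4) by (simp add: T_def)
    qed
    then obtain g where g: "inj_on g (I - J)" "\<forall>i\<in>I - J. g i \<in> A i - T" by blast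
    define h where "h = (\<lambda>i. if i \<in> J then f i else g i)"
    have "inj_on h I"
    proof (rule inj_onI)
      fix a b assume ab: "a \<in> I" "b \<in> I" "h a = h b"
      have fT: "f i \<in> T" if "i \<in> J" for i using f(2) that by (auto simp: T_def)
      show "a = b"
        using ab g(2) fT inj_onD[OF f(1), of a b] inj_onD[OF g(1), of a b]
        by (cases "a \<in> J"; cases "b \<in> J") (auto simp: h_def, (metis Diff_iff)+)
    qed
    moreover have "\<forall>i\<in>I. h i \<in> A i" using f g by (auto simp: h_def)
    ultimately show ?thesis by blast
  next
    case False
    show ?thesis
    proof (cases "I = {}")
      case True then show ?thesis by auto
    next
      case ne: False
      then obtain a where a: "a \<in> I" by blast
      have "card {a} \<le> card (\<Union>i\<in>{a}. A i)" using a by (intro hall) auto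
      then obtain y where y: "y \<in> A a" by (cases "A a = {}") auto
      have "\<exists>g. inj_on g (I - {a}) \<and> (\<forall>i\<in>I - {a}. g i \<in> A i - {y})"
      proof (rule less.hyps)
        show "card (I - {a}) < card I" using a fin by (meson card_Diff1_less)
        show "finite (I - {a})" using fin by simp
        show "finite (A i - {y})" if "i \<in> I - {a}" for i using finA that by simp
        fix L assume L: "L \<subseteq> I - {a}"
        show "card L \<le> card (\<Union>i\<in>L. A i - {y})"
        proof (cases "L = {}")
          case nL: False
          have "L \<subseteq> I" "L \<noteq> I" using L a by auto
          then have "card L \<noteq> card (\<Union>i\<in>L. A i)" "card L \<le> card (\<Union>i\<in>L. A i)"
            using False nL hall by blast+
          moreover have "(\<Union>i\<in>L. A i - {y}) = (\<Union>i\<in>L. A i) - {y}" by auto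
          moreover have "card (\<Union>i\<in>L. A i) \<le> Suc (card ((\<Union>i\<in>L. A i) - {y}))"
            by (simp add: card_Diff_singleton_if) arith
          ultimately show ?thesis by simp
        qed simp
      qed
      then obtain g where g: "inj_on g (I - {a})" "\<forall>i\<in>I - {a}. g i \<in> A i - {y}" by blast
      define h where "h = (\<lambda>i. if i = a then y else g i)"
      have "inj_on h I" using g by (auto simp: h_def inj_on_def)
      moreover have "\<forall>i\<in>I. h i \<in> A i" using g y by (auto simp: h_def)
      ultimately show ?thesis by blast
    qed
  qed
qed

text \<open>Birkhoff's theorem by peeling: Hall gives a perfect matching on the support of
  \<open>x\<close>; subtracting its smallest entry \<open>e\<close> keeps all line sums equal and
  shrinks the support. The cost splits accordingly, so the cheaper of this matching and the one
  found in the remainder suffices. A general \<open>s\<close> avoids rescaling.\<close>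

lemma doubly_stochastic_min_matching:
  fixes x w :: "'r \<Rightarrow> 'c \<Rightarrow> real"
  assumes "finite R" "finite C" "card R = card C" "s > 0"
    and "\<And>r c. r \<in> R \<Longrightarrow> c \<in> C \<Longrightarrow> x r c \<ge> 0"
    and "\<And>r. r \<in> R \<Longrightarrow> (\<Sum>c\<in>C. x r c) = s"
    and "\<And>c. c \<in> C \<Longrightarrow> (\<Sum>r\<in>R. x r c) = s"
  shows "\<exists>m. inj_on m R \<and> m ` R \<subseteq> C \<and> (\<forall>r\<in>R. x r (m r) > 0) \<and>
           s * (\<Sum>r\<in>R. w r (m r)) \<le> (\<Sum>r\<in>R. \<Sum>c\<in>C. x r c * w r c)"
  using assms(4-)
proof (induction "card {p \<in> R \<times> C. x (fst p) (snd p) > 0}" arbitrary: x s rule: less_induct)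
  case less
  note pos = less.prems(2) and rows = less.prems(3) and cols = less.prems(4)
  have "\<exists>m. inj_on m R \<and> (\<forall>r\<in>R. m r \<in> {c \<in> C. x r c > 0})"
  proof (rule Hall_marriage)
    fix J assume J: "J \<subseteq> R"
    define T where "T = (\<Union>r\<in>J. {c \<in> C. x r c > 0})"
    have T: "T \<subseteq> C" "finite T" using \<open>finite C\<close> by (auto simp: T_def intro: finite_subset)
    \<comment> \<open>Hall's condition by counting mass: the rows in \<open>J\<close> have mass
      \<open>s\<close> each, all of it in the columns \<open>T\<close>, and a column holds only
      \<open>s\<close>.\<close>
    have "real (card J) * s = (\<Sum>r\<in>J. \<Sum>c\<in>C. x r c)" using rows J by (simp add: subset_eq)
    also have "\<dots> = (\<Sum>r\<in>J. \<Sum>c\<in>T. x r c)"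
    proof (rule sum.cong[OF refl])
      fix r assume r: "r \<in> J"
      have "x r c = 0" if "c \<in> C - T" for c
      proof -
        have "\<not> x r c > 0" using that r by (auto simp: T_def)
        with pos[of r c] r J that show ?thesis by fastforce
      qed
      then show "(\<Sum>c\<in>C. x r c) = (\<Sum>c\<in>T. x r c)"
        using T \<open>finite C\<close> by (intro sum.mono_neutral_right) auto
    qed
    also have "\<dots> = (\<Sum>c\<in>T. \<Sum>r\<in>J. x r c)" by (rule sum.swap)
    also have "\<dots> \<le> (\<Sum>c\<in>T. \<Sum>r\<in>R. x r c)"
      using J T pos \<open>finite R\<close> by (intro sum_mono sum_mono2) auto
    also have "\<dots> = real (card T) * s" using cols T by (simp add: subset_eq)
    finally show "card J \<le> card (\<Union>r\<in>J. {c \<in> C. x r c > 0})"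
      using \<open>s > 0\<close> by (simp add: T_def)
  qed (use \<open>finite R\<close> \<open>finite C\<close> in auto)
  then obtain m where m: "inj_on m R" "\<And>r. r \<in> R \<Longrightarrow> m r \<in> C" "\<And>r. r \<in> R \<Longrightarrow> x r (m r) > 0"
    by blast
  have img: "m ` R = C"
    using m assms(1-3) by (intro card_subset_eq) (auto simp: card_image)
  show ?case
  proof (cases "R = {}")
    case True
    then show ?thesis by auto
  next
    case False
    define e where "e = Min ((\<lambda>r. x r (m r)) ` R)"
    have e_le: "e \<le> x r (m r)" if "r \<in> R" for r using that \<open>finite R\<close> by (simp add: e_def)
    have "e \<in> (\<lambda>r. x r (m r)) ` R" unfolding e_def using \<open>finite R\<close> False by (intro Min_in) auto
    then obtain r0 where r0: "r0 \<in> R" "e = x r0 (m r0)" by blast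
    have e0: "e > 0" using r0 m by simp
    define y where "y = (\<lambda>r c. x r c - (if m r = c then e else 0))"
    have y0: "y r c \<ge> 0" if "r \<in> R" "c \<in> C" for r c using pos that e_le by (auto simp: y_def)
    have yr: "(\<Sum>c\<in>C. y r c) = s - e" if "r \<in> R" for r
      using rows[OF that] m(2)[OF that] \<open>finite C\<close> by (simp add: y_def sum_subtractf)
    have yc: "(\<Sum>r\<in>R. y r c) = s - e" if c: "c \<in> C" for c
    proof -
      obtain r1 where r1: "r1 \<in> R" "m r1 = c" using img c by blast
      then have "(\<Sum>r\<in>R. if m r = c then e else 0) = (\<Sum>r\<in>R. if r = r1 then e else 0)"
        using m(1) by (intro sum.cong) (auto simp: inj_on_def)
      then show ?thesis using cols[OF c] r1 \<open>finite R\<close> by (simp add: y_def sum_subtractf)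
    qed
    have cost: "(\<Sum>r\<in>R. \<Sum>c\<in>C. x r c * w r c) = (\<Sum>r\<in>R. \<Sum>c\<in>C. y r c * w r c) + e * (\<Sum>r\<in>R. w r (m r))"
    proof -
      have "(\<Sum>c\<in>C. x r c * w r c) = (\<Sum>c\<in>C. y r c * w r c) + e * w r (m r)" if "r \<in> R" for r
      proof -
        have "(\<Sum>c\<in>C. x r c * w r c) = (\<Sum>c\<in>C. y r c * w r c + (if m r = c then e * w r c else 0))"
          by (intro sum.cong) (auto simp: y_def algebra_simps)
        then show ?thesis using m(2)[OF that] \<open>finite C\<close> by (simp add: sum.distrib)
      qed
      then show ?thesis by (simp add: sum.distrib sum_distrib_left)
    qed
    show ?thesis
    proof (cases "s - e > 0")
      case True
      have sub: "{p \<in> R \<times> C. y (fst p) (snd p) > 0} \<subset> {p \<in> R \<times> C. x (fst p) (snd p) > 0}"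
      proof
        show "{p \<in> R \<times> C. y (fst p) (snd p) > 0} \<subseteq> {p \<in> R \<times> C. x (fst p) (snd p) > 0}"
          using e0 by (auto simp: y_def split: if_splits)
        have "(r0, m r0) \<in> {p \<in> R \<times> C. x (fst p) (snd p) > 0}"
          "(r0, m r0) \<notin> {p \<in> R \<times> C. y (fst p) (snd p) > 0}" using r0 m by (auto simp: y_def)
        then show "{p \<in> R \<times> C. y (fst p) (snd p) > 0} \<noteq> {p \<in> R \<times> C. x (fst p) (snd p) > 0}" by blast
      qed
      have "card {p \<in> R \<times> C. y (fst p) (snd p) > 0} < card {p \<in> R \<times> C. x (fst p) (snd p) > 0}"
        using sub \<open>finite R\<close> \<open>finite C\<close> by (intro psubset_card_mono) auto
      from less.hyps[OF this True y0 yr yc]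
      obtain m' where m': "inj_on m' R" "m' ` R \<subseteq> C" "\<And>r. r \<in> R \<Longrightarrow> y r (m' r) > 0"
        "(s - e) * (\<Sum>r\<in>R. w r (m' r)) \<le> (\<Sum>r\<in>R. \<Sum>c\<in>C. y r c * w r c)" by blast
      have m'x: "x r (m' r) > 0" if "r \<in> R" for r
        using m'(3)[OF that] e0 by (auto simp: y_def split: if_splits)
      show ?thesis
      proof (cases "(\<Sum>r\<in>R. w r (m r)) \<le> (\<Sum>r\<in>R. w r (m' r))")
        case True
        have "s * (\<Sum>r\<in>R. w r (m r)) = (s - e) * (\<Sum>r\<in>R. w r (m r)) + e * (\<Sum>r\<in>R. w r (m r))"
          by (simp add: algebra_simps)
        also have "\<dots> \<le> (s - e) * (\<Sum>r\<in>R. w r (m' r)) + e * (\<Sum>r\<in>R. w r (m r))"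
          using True \<open>s - e > 0\<close> by (intro add_right_mono mult_left_mono) auto
        finally have "s * (\<Sum>r\<in>R. w r (m r)) \<le> (\<Sum>r\<in>R. \<Sum>c\<in>C. x r c * w r c)" using m'(4) cost by linarith
        then show ?thesis using m img by blast
      next
        case False
        then have "e * (\<Sum>r\<in>R. w r (m' r)) \<le> e * (\<Sum>r\<in>R. w r (m r))" using e0 by (intro mult_left_mono) auto
        then have "s * (\<Sum>r\<in>R. w r (m' r)) \<le> (\<Sum>r\<in>R. \<Sum>c\<in>C. x r c * w r c)"
          using m'(4) cost by (simp add: algebra_simps)
        then show ?thesis using m' m'x by blast
      qed
    next
      case False
      have "s - e = 0" using False yr[OF r0(1)] sum_nonneg[of C "y r0"] y0 r0 by fastforce
      then have "y r c = 0" if "r \<in> R" "c \<in> C" for r c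
        using yr[OF that(1)] y0[OF that(1)] that(2) sum_nonneg_eq_0_iff[of C "y r"] \<open>finite C\<close> by simp
      then have "(\<Sum>r\<in>R. \<Sum>c\<in>C. y r c * w r c) = 0" by simp
      then have "s * (\<Sum>r\<in>R. w r (m r)) \<le> (\<Sum>r\<in>R. \<Sum>c\<in>C. x r c * w r c)"
        using cost \<open>s - e = 0\<close> by simp
      then show ?thesis using m img by blast
    qed
  qed
qed

text \<open>Dummy rows \<open>Inr t\<close> of cost 0 share the slack of the columns equally, which
  makes the matrix doubly stochastic. The elements of \<open>T \<subseteq> C\<close> merely name the
  right number of dummy rows.\<close>

lemma fractional_matching_rounding:
  fixes x w :: "'r \<Rightarrow> 'c \<Rightarrow> real"
  assumes fin: "finite R" "finite C"
    and pos: "\<And>r c. r \<in> R \<Longrightarrow> c \<in> C \<Longrightarrow> x r c \<ge> 0"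
    and rows: "\<And>r. r \<in> R \<Longrightarrow> (\<Sum>c\<in>C. x r c) = 1"
    and cols: "\<And>c. c \<in> C \<Longrightarrow> (\<Sum>r\<in>R. x r c) \<le> 1"
  shows "\<exists>m. inj_on m R \<and> m ` R \<subseteq> C \<and> (\<forall>r\<in>R. x r (m r) > 0) \<and>
           (\<Sum>r\<in>R. w r (m r)) \<le> (\<Sum>r\<in>R. \<Sum>c\<in>C. x r c * w r c)"
proof -
  have tot: "(\<Sum>c\<in>C. \<Sum>r\<in>R. x r c) = card R"
    by (subst sum.swap) (simp add: rows)
  have "(\<Sum>c\<in>C. \<Sum>r\<in>R. x r c) \<le> (\<Sum>c\<in>C. 1)" by (intro sum_mono cols)
  then have "card R \<le> card C" using tot by simp
  then obtain T where T: "T \<subseteq> C" "card T = card C - card R"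
    by (meson diff_le_self obtain_subset_with_card_n)
  have finT: "finite T" using T fin finite_subset by blast
  define R' where "R' = Inl ` R \<union> Inr ` T"
  define x' where "x' = (\<lambda>r c. case r of Inl r \<Rightarrow> x r c | Inr (t :: 'c) \<Rightarrow> (1 - (\<Sum>r\<in>R. x r c)) / card T)"
  define w' where "w' = (\<lambda>r c. case r of Inl r \<Rightarrow> w r c | Inr (t :: 'c) \<Rightarrow> 0)"
  have split: "(\<Sum>r\<in>R'. f r) = (\<Sum>r\<in>R. f (Inl r)) + (\<Sum>t\<in>T. f (Inr t))" for f :: "'r + 'c \<Rightarrow> real"
    unfolding R'_def using fin finT
    by (subst sum.union_disjoint) (auto simp: sum.reindex)
  have cardT: "real (card T) = real (card C) - real (card R)" using T \<open>card R \<le> card C\<close> by simp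
  have "\<exists>m. inj_on m R' \<and> m ` R' \<subseteq> C \<and> (\<forall>r\<in>R'. x' r (m r) > 0) \<and>
           1 * (\<Sum>r\<in>R'. w' r (m r)) \<le> (\<Sum>r\<in>R'. \<Sum>c\<in>C. x' r c * w' r c)"
  proof (rule doubly_stochastic_min_matching)
    show "finite R'" using fin finT by (simp add: R'_def)
    have "card R' = card R + card T" unfolding R'_def using fin finT
      by (subst card_Un_disjoint) (auto simp: card_image)
    then show "card R' = card C" using T \<open>card R \<le> card C\<close> by simp
    show "x' r c \<ge> 0" if "r \<in> R'" "c \<in> C" for r c
      using that pos cols by (auto simp: x'_def R'_def)
    show "(\<Sum>c\<in>C. x' r c) = 1" if r: "r \<in> R'" for r
    proof (cases r)
      case (Inl a)
      then show ?thesis using r rows by (auto simp: x'_def R'_def)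
    next
      case (Inr t)
      then have "t \<in> T" using r by (auto simp: R'_def)
      then have "card T > 0" using finT card_gt_0_iff by blast
      have "(\<Sum>c\<in>C. 1 - (\<Sum>r\<in>R. x r c)) = card T" using tot cardT by (simp add: sum_subtractf)
      then show ?thesis using Inr \<open>card T > 0\<close> by (simp add: x'_def flip: sum_divide_distrib)
    qed
    show "(\<Sum>r\<in>R'. x' r c) = 1" if c: "c \<in> C" for c
    \<comment> \<open>Without dummy rows the total slack is 0, so every column sum already equals
      1.\<close>
    proof (cases "card T = 0")
      case True
      then have "(\<Sum>c\<in>C. 1 - (\<Sum>r\<in>R. x r c)) = 0" using tot cardT by (simp add: sum_subtractf)
      then have "1 - (\<Sum>r\<in>R. x r c) = 0" using c cols fin by (subst (asm) sum_nonneg_eq_0_iff) auto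
      then show ?thesis using True finT by (simp add: split x'_def)
    next
      case False
      then show ?thesis by (simp add: split x'_def)
    qed
  qed (use fin in auto)
  then obtain m where m: "inj_on m R'" "m ` R' \<subseteq> C" "\<And>r. r \<in> R' \<Longrightarrow> x' r (m r) > 0"
    "(\<Sum>r\<in>R'. w' r (m r)) \<le> (\<Sum>r\<in>R'. \<Sum>c\<in>C. x' r c * w' r c)" by auto
  have "inj_on (m \<circ> Inl) R" using m(1) by (auto simp: inj_on_def R'_def)
  moreover have "(m \<circ> Inl) ` R \<subseteq> C" using m(2) by (auto simp: R'_def)
  moreover have "\<forall>r\<in>R. x r ((m \<circ> Inl) r) > 0" using m(3)[of "Inl _"] by (auto simp: R'_def x'_def)
  moreover have "(\<Sum>r\<in>R. w r ((m \<circ> Inl) r)) \<le> (\<Sum>r\<in>R. \<Sum>c\<in>C. x r c * w r c)"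
    using m(4) by (simp add: split w'_def x'_def)
  ultimately show ?thesis by blast
qed

text \<open>The weighted sum of the \<open>g i\<close> is again affine in the matching and has mean
  at most 0 under \<open>x\<close>; rounding for the combined cost \<open>W\<close> does not exceed
  this mean. The affine form is only asked for on injective \<open>m\<close>, which is what overlaps
  of weights need.\<close>

lemma affine_matching_rounding:
  fixes x :: "'r \<Rightarrow> 'c \<Rightarrow> real" and g :: "'i \<Rightarrow> ('r \<Rightarrow> 'c) \<Rightarrow> real"
  assumes fin: "finite S" "finite C" "finite I"
    and pos: "\<And>u c. u \<in> S \<Longrightarrow> c \<in> C \<Longrightarrow> x u c \<ge> 0"
    and rows: "\<And>u. u \<in> S \<Longrightarrow> (\<Sum>c\<in>C. x u c) = 1"
    and cols: "\<And>c. c \<in> C \<Longrightarrow> (\<Sum>u\<in>S. x u c) \<le> 1"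
    and wt: "\<And>i. i \<in> I \<Longrightarrow> wt i \<ge> 0"
    and aff: "\<And>i. i \<in> I \<Longrightarrow> \<exists>a w. (\<forall>m. inj_on m S \<and> m ` S \<subseteq> C \<longrightarrow> g i m = a + (\<Sum>u\<in>S. w u (m u))) \<and>
                a + (\<Sum>u\<in>S. \<Sum>c\<in>C. x u c * w u c) \<le> 0"
  shows "\<exists>m. inj_on m S \<and> m ` S \<subseteq> C \<and> (\<forall>u\<in>S. x u (m u) > 0) \<and> (\<Sum>i\<in>I. wt i * g i m) \<le> 0"
proof -
  define good where "good = (\<lambda>i p. (\<forall>m. inj_on m S \<and> m ` S \<subseteq> C \<longrightarrow> g i m = fst p + (\<Sum>u\<in>S. snd p u (m u))) \<and>
                fst p + (\<Sum>u\<in>S. \<Sum>c\<in>C. x u c * snd p u c) \<le> 0)"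
  have "\<exists>p. good i p" if "i \<in> I" for i
    using aff[OF that] unfolding good_def by auto
  then obtain p where p: "\<And>i. i \<in> I \<Longrightarrow> good i (p i)" by metis
  define a w where "a = (\<lambda>i. fst (p i))" and "w = (\<lambda>i. snd (p i))"
  have aff: "g i m = a i + (\<Sum>u\<in>S. w i u (m u))" if "i \<in> I" "inj_on m S" "m ` S \<subseteq> C" for i m
    using p[OF that(1)] that(2,3) unfolding good_def a_def w_def by blast
  have le: "a i + (\<Sum>u\<in>S. \<Sum>c\<in>C. x u c * w i u c) \<le> 0" if "i \<in> I" for i
    using p[OF that] unfolding good_def a_def w_def by blast
  define W where "W = (\<lambda>u c. \<Sum>i\<in>I. wt i * w i u c)"
  obtain m where m: "inj_on m S" "m ` S \<subseteq> C" "\<forall>u\<in>S. x u (m u) > 0"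
    "(\<Sum>u\<in>S. W u (m u)) \<le> (\<Sum>u\<in>S. \<Sum>c\<in>C. x u c * W u c)"
    using fractional_matching_rounding[OF fin(1,2) pos rows cols, of W] by blast
  have "(\<Sum>i\<in>I. wt i * g i m) = (\<Sum>i\<in>I. wt i * a i) + (\<Sum>i\<in>I. \<Sum>u\<in>S. wt i * w i u (m u))"
    by (simp add: aff[OF _ m(1,2)] algebra_simps sum.distrib sum_distrib_left)
  also have "(\<Sum>i\<in>I. \<Sum>u\<in>S. wt i * w i u (m u)) = (\<Sum>u\<in>S. W u (m u))"
    unfolding W_def by (rule sum.swap)
  also have "\<dots> \<le> (\<Sum>u\<in>S. \<Sum>c\<in>C. x u c * W u c)" by (rule m(4))
  also have "\<dots> = (\<Sum>u\<in>S. \<Sum>c\<in>C. \<Sum>i\<in>I. wt i * (x u c * w i u c))"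
    by (simp add: W_def sum_distrib_left mult_ac)
  also have "\<dots> = (\<Sum>u\<in>S. \<Sum>i\<in>I. \<Sum>c\<in>C. wt i * (x u c * w i u c))"
    by (intro sum.cong refl) (rule sum.swap)
  also have "\<dots> = (\<Sum>i\<in>I. \<Sum>u\<in>S. \<Sum>c\<in>C. wt i * (x u c * w i u c))" by (rule sum.swap)
  also have "(\<Sum>i\<in>I. wt i * a i) + \<dots> = (\<Sum>i\<in>I. wt i * (a i + (\<Sum>u\<in>S. \<Sum>c\<in>C. x u c * w i u c)))"
    by (simp add: sum.distrib sum_distrib_left algebra_simps)
  also have "\<dots> \<le> 0" using le wt by (intro sum_nonpos mult_nonneg_nonpos)
  finally show ?thesis using m by auto
qed

section \<open>Exponential potentials and overloaded colors\<close>

lemma exp_le_quadratic: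
  fixes y :: real
  assumes "\<bar>y\<bar> \<le> 1"
  shows "exp y \<le> 1 + y + y\<^sup>2"
proof (cases "y \<ge> 0")
  case True
  then show ?thesis using assms exp_bound[of y] by simp
next
  case False
  define z where "z = - y"
  have z: "0 < z" "z \<le> 1" using False assms by (auto simp: z_def)
  have e: "exp z \<ge> 1 + z" using exp_ge_add_one_self[of z] by simp
  \<comment> \<open>The product equals \<open>1 + z ^ 3\<close>.\<close>
  have "1 \<le> (1 - z + z\<^sup>2) * (1 + z)"
    using z by (simp add: power2_eq_square algebra_simps)
  also have "\<dots> \<le> (1 - z + z\<^sup>2) * exp z"
    using e z by (intro mult_left_mono) auto
  finally have "inverse (exp z) \<le> 1 - z + z\<^sup>2"
    by (simp add: field_simps)
  then show ?thesis by (simp add: z_def exp_minus)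
qed

text \<open>Whenever a quantity may move, its age grows by at least 1, and the resulting factor
  \<open>exp (- B)\<close> with \<open>B = (l * b)\<^sup>2\<close> pays for the quadratic term of
  \<open>exp\<close>. Only the first-order change remains, which \<open>lin\<close>
  controls.\<close>

lemma exponential_potential_step:
  fixes Q Q' e e' :: "'i \<Rightarrow> real"
  assumes fin: "finite I" and lam: "l > 0" "l * b \<le> 1" and b: "b \<ge> 0"
    and bnd: "\<And>i. i \<in> I \<Longrightarrow> \<bar>Q' i - Q i\<bar> \<le> b"
    and lin: "(\<Sum>i\<in>I. exp (l * Q i - (l * b)\<^sup>2 * e i) * (Q' i - Q i)) \<le> 0"
    and e: "\<And>i. i \<in> I \<Longrightarrow> e' i \<ge> e i + 1 \<or> (e' i = e i \<and> Q' i = Q i)"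
  shows "(\<Sum>i\<in>I. exp (l * Q' i - (l * b)\<^sup>2 * e' i)) \<le> (\<Sum>i\<in>I. exp (l * Q i - (l * b)\<^sup>2 * e i))"
proof -
  define B where "B = (l * b)\<^sup>2"
  define P where "P = (\<lambda>i. exp (l * Q i - B * e i))"
  have B0: "B \<ge> 0" by (simp add: B_def)
  have eB: "exp (- B) * (1 + B) \<le> 1"
    using exp_ge_add_one_self[of B] by (simp add: exp_minus field_simps)
  \<comment> \<open>The coefficient \<open>exp (- B) * l\<close> is the same for all
    \<open>i\<close>, including unchanged quantities, whose linear term is 0; hence
    \<open>lin\<close> applies to the whole sum.\<close>
  have step: "exp (l * Q' i - B * e' i) \<le> P i + exp (- B) * l * (P i * (Q' i - Q i))" if i: "i \<in> I" for i
    using e[OF i]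
  proof
    assume e1: "e' i \<ge> e i + 1"
    have D: "\<bar>l * (Q' i - Q i)\<bar> \<le> l * b" using bnd[OF i] lam by (simp add: abs_mult)
    have "l * Q' i - B * e' i \<le> (l * Q i - B * e i) + l * (Q' i - Q i) + (- B)"
      using mult_left_mono[OF e1 B0] by (simp add: algebra_simps)
    then have "exp (l * Q' i - B * e' i) \<le> exp ((l * Q i - B * e i) + l * (Q' i - Q i) + (- B))" by simp
    also have "\<dots> = P i * exp (- B) * exp (l * (Q' i - Q i))"
      by (simp only: exp_add P_def mult_ac)
    also have "\<dots> \<le> P i * exp (- B) * (1 + l * (Q' i - Q i) + B)"
    proof (rule mult_left_mono)
      have "(l * (Q' i - Q i))\<^sup>2 \<le> B" unfolding B_def using D by (metis abs_ge_zero power2_abs power_mono)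
      moreover have "exp (l * (Q' i - Q i)) \<le> 1 + l * (Q' i - Q i) + (l * (Q' i - Q i))\<^sup>2"
        using D lam by (intro exp_le_quadratic) linarith
      ultimately show "exp (l * (Q' i - Q i)) \<le> 1 + l * (Q' i - Q i) + B" by linarith
    qed (simp add: P_def)
    also have "\<dots> = P i * (exp (- B) * (1 + B)) + exp (- B) * l * (P i * (Q' i - Q i))"
      by (simp add: algebra_simps)
    also have "P i * (exp (- B) * (1 + B)) \<le> P i * 1" using eB by (intro mult_left_mono) (auto simp: P_def)
    finally show ?thesis by simp
  qed (simp add: P_def)
  have "(\<Sum>i\<in>I. exp (l * Q' i - B * e' i)) \<le> (\<Sum>i\<in>I. P i + exp (- B) * l * (P i * (Q' i - Q i)))"
    by (intro sum_mono step)
  also have "\<dots> = (\<Sum>i\<in>I. P i) + exp (- B) * l * (\<Sum>i\<in>I. P i * (Q' i - Q i))"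
    by (simp add: sum.distrib sum_distrib_left)
  also have "\<dots> \<le> (\<Sum>i\<in>I. P i)"
    using lin lam by (simp add: P_def B_def mult_nonneg_nonpos)
  finally show ?thesis by (simp add: P_def B_def)
qed

text \<open>Chebyshev's inequality for the loads \<open>\<Sum>u\<in>S. M u c\<close> around
  \<open>card S\<close>: off-diagonal pairs are bounded by \<open>Z\<close>, the diagonal by
  \<open>B\<^sup>2\<close>. In the factor \<open>3 * d\<close>, one \<open>d\<close> stems from the
  overlaps and two from the totals.\<close>

lemma card_overloaded_le:
  fixes M :: "'u \<Rightarrow> 'c \<Rightarrow> real" and B d K :: real
  assumes fin: "finite S" "finite C"
    and M: "\<And>u c. u \<in> S \<Longrightarrow> c \<in> C \<Longrightarrow> 0 \<le> M u c \<and> M u c \<le> B"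
    and Z: "\<And>u v. u \<in> S \<Longrightarrow> v \<in> S \<Longrightarrow> u \<noteq> v \<Longrightarrow> (\<Sum>c\<in>C. M u c * M v c) \<le> card C * (1 + d)"
    and R: "\<And>u. u \<in> S \<Longrightarrow> (\<Sum>c\<in>C. M u c) \<ge> card C * (1 - d)"
    and d: "d \<ge> 0" and K: "K \<ge> card S"
  shows "card {c \<in> C. (\<Sum>u\<in>S. M u c) > K} * (K - card S)\<^sup>2 \<le> card C * (3 * d * (real (card S))\<^sup>2 + B\<^sup>2 * card S)"
proof -
  define s where "s = real (card S)"
  define k where "k = real (card C)"
  define L where "L = (\<lambda>c. \<Sum>u\<in>S. M u c)"
  have L2: "(\<Sum>c\<in>C. (L c)\<^sup>2) = (\<Sum>u\<in>S. \<Sum>v\<in>S. \<Sum>c\<in>C. M u c * M v c)"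
  proof -
    have "(\<Sum>c\<in>C. (L c)\<^sup>2) = (\<Sum>c\<in>C. \<Sum>u\<in>S. \<Sum>v\<in>S. M u c * M v c)"
      by (simp add: L_def power2_eq_square sum_product)
    also have "\<dots> = (\<Sum>u\<in>S. \<Sum>c\<in>C. \<Sum>v\<in>S. M u c * M v c)" by (rule sum.swap)
    also have "\<dots> = (\<Sum>u\<in>S. \<Sum>v\<in>S. \<Sum>c\<in>C. M u c * M v c)"
      by (intro sum.cong refl) (rule sum.swap)
    finally show ?thesis .
  qed
  also have "\<dots> \<le> (\<Sum>u\<in>S. \<Sum>v\<in>S. k * (1 + d) + (if u = v then k * B\<^sup>2 else 0))"
  proof (intro sum_mono)
    fix u v assume uv: "u \<in> S" "v \<in> S"
    show "(\<Sum>c\<in>C. M u c * M v c) \<le> k * (1 + d) + (if u = v then k * B\<^sup>2 else 0)"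
    proof (cases "u = v")
      case True
      have "(\<Sum>c\<in>C. M u c * M v c) \<le> (\<Sum>c\<in>C. B\<^sup>2)"
        using M uv unfolding power2_eq_square by (intro sum_mono mult_mono) (auto intro: order_trans)
      also have "\<dots> = k * B\<^sup>2" by (simp add: k_def)
      finally show ?thesis using True d by (simp add: k_def add_increasing)
    qed (use Z uv in \<open>auto simp: k_def\<close>)
  qed
  also have "\<dots> = s\<^sup>2 * k * (1 + d) + s * k * B\<^sup>2"
    using fin by (simp add: sum.distrib s_def power2_eq_square algebra_simps)
  finally have A: "(\<Sum>c\<in>C. (L c)\<^sup>2) \<le> s\<^sup>2 * k * (1 + d) + s * k * B\<^sup>2" .
  have "(\<Sum>c\<in>C. L c) = (\<Sum>u\<in>S. \<Sum>c\<in>C. M u c)" unfolding L_def by (rule sum.swap)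
  also have "\<dots> \<ge> (\<Sum>u\<in>S. k * (1 - d))" using R unfolding k_def by (intro sum_mono)
  finally have L1: "(\<Sum>c\<in>C. L c) \<ge> s * (k * (1 - d))" by (simp add: s_def)
  have "(\<Sum>c\<in>C. (L c - s)\<^sup>2) = (\<Sum>c\<in>C. (L c)\<^sup>2) - 2 * s * (\<Sum>c\<in>C. L c) + k * s\<^sup>2"
    by (simp add: power2_diff sum.distrib sum_subtractf k_def sum_distrib_left sum_distrib_right mult_ac)
  also have "\<dots> \<le> s\<^sup>2 * k * (1 + d) + s * k * B\<^sup>2 - 2 * s * (s * (k * (1 - d))) + k * s\<^sup>2"
    using A mult_left_mono[OF L1, of "2 * s"] by (simp add: s_def)
  also have "\<dots> = k * (3 * d * s\<^sup>2 + B\<^sup>2 * s)" by (simp add: power2_eq_square algebra_simps)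
  finally have V: "(\<Sum>c\<in>C. (L c - s)\<^sup>2) \<le> k * (3 * d * s\<^sup>2 + B\<^sup>2 * s)" .
  have "card {c \<in> C. L c > K} * (K - s)\<^sup>2 = (\<Sum>c\<in>{c \<in> C. L c > K}. (K - s)\<^sup>2)" by simp
  also have "\<dots> \<le> (\<Sum>c\<in>{c \<in> C. L c > K}. (L c - s)\<^sup>2)"
    using K by (intro sum_mono power_mono) (auto simp: s_def)
  also have "\<dots> \<le> (\<Sum>c\<in>C. (L c - s)\<^sup>2)" using fin by (intro sum_mono2) auto
  finally show ?thesis using V by (simp add: L_def s_def k_def)
qed

section \<open>The weights during one arrival\<close>

locale reweighting =
  fixes K :: real and k :: nat and S G C :: "nat set" and M x :: "nat \<Rightarrow> nat \<Rightarrow> real"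
  assumes K: "K \<ge> 1000000" "real k \<le> K"
    and fin: "finite S" "finite C"
    and GC: "G = C \<inter> {..<k}"
    and M: "\<And>u c. 0 \<le> M u c" "\<And>u c. M u c \<le> 5"
    and x: "\<And>u c. u \<in> S \<Longrightarrow> c \<in> G \<Longrightarrow> x u c = M u c / K"
begin

text \<open>
  \<open>S\<close> is the neighbourhood of the arriving node, \<open>C\<close> consists of the colors \<open>G\<close> that are not
  overloaded and of dummy columns \<open>\<ge> k\<close>. A node \<open>u\<close> takes \<open>c \<in> G\<close> with probability \<open>M u c / K\<close>;
  then \<open>M u c\<close> drops to 0, and otherwise it is divided by \<open>1 - M u c / K\<close>, which preserves its mean.
\<close>

definition gain :: "nat \<Rightarrow> nat \<Rightarrow> real" where
  "gain u c = (if u \<in> S \<and> c \<in> G then (M u c)\<^sup>2 / (K - M u c) else 0)"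

text \<open>The weight a surviving color would get, hence the amount lost when it is taken. It
  vanishes outside \<open>S\<close> and \<open>G\<close>, so \<open>reweight\<close> treats dummy
  columns and non-neighbours without case distinctions.\<close>

definition peak :: "nat \<Rightarrow> nat \<Rightarrow> real" where
  "peak u c = (if u \<in> S \<and> c \<in> G then M u c + gain u c else 0)"

definition reweight :: "(nat \<Rightarrow> nat) \<Rightarrow> nat \<Rightarrow> nat \<Rightarrow> real" where
  "reweight m u c = M u c + gain u c - (if m u = c then peak u c else 0)"

lemma G_iff: "c \<in> G \<longleftrightarrow> c \<in> C \<and> c < k"
  by (simp add: GC)

lemma weight_less_K: "K - M u c > 0"
  using K M(2)[of u c] by linarith

lemma peak_eq: "u \<in> S \<Longrightarrow> c \<in> G \<Longrightarrow> peak u c = M u c * K / (K - M u c)"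
  using weight_less_K[of u c] by (simp add: peak_def gain_def field_simps power2_eq_square)

text \<open>The martingale property: the expected loss equals the gain granted in advance.\<close>

lemma x_peak: "u \<in> S \<Longrightarrow> c \<in> G \<Longrightarrow> x u c * peak u c = gain u c"
  using weight_less_K[of u c] K by (simp add: x peak_eq gain_def power2_eq_square)

lemma gain_nonneg: "gain u c \<ge> 0"
  using weight_less_K[of u c] by (simp add: gain_def)

lemma gain_le: "gain u c \<le> 50 / K"
proof -
  have "(M u c)\<^sup>2 / (K - M u c) \<le> 5\<^sup>2 / (K - 5)"
    using M[of u c] K by (intro frac_le power_mono) auto
  also have "\<dots> \<le> 50 / K" using K by (simp add: field_simps)
  finally show ?thesis using K by (simp add: gain_def)
qed

lemma gain_le_1: "gain u c \<le> 1"
proof -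
  have "50 / K \<le> 1" using K by (simp add: field_simps)
  then show ?thesis using gain_le[of u c] by linarith
qed

lemma peak_bounds: "0 \<le> peak u c" "peak u c \<le> 6" "peak u c \<le> M u c + gain u c"
  using M[of u c] gain_nonneg[of u c] gain_le_1[of u c] by (auto simp: peak_def)

lemma reweight_bounds: "0 \<le> reweight m u c" "reweight m u c \<le> 6"
  using M[of u c] gain_nonneg[of u c] gain_le_1[of u c] peak_bounds[of u c]
  by (auto simp: reweight_def)

section \<open>Means of affine functionals of the matching\<close>

lemma sum_peak:
  assumes "u \<in> S \<Longrightarrow> m u \<in> C"
  shows "(\<Sum>c<k. (if m u = c then peak u c else 0) * g c) = peak u (m u) * g (m u)"
proof (cases "m u < k")
  case True
  have "(\<Sum>c<k. (if m u = c then peak u c else 0) * g c) = (\<Sum>c<k. if m u = c then peak u c * g c else 0)"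
    by (intro sum.cong) auto
  then show ?thesis using True by simp
next
  case False
  then have "peak u (m u) = 0" by (auto simp: peak_def G_iff)
  then show ?thesis using False by (auto intro!: sum.neutral)
qed

lemma sum_x_peak:
  assumes "u \<in> S"
  shows "(\<Sum>c\<in>C. x u c * (peak u c * g c)) = (\<Sum>c<k. gain u c * g c)"
proof -
  have "(\<Sum>c\<in>C. x u c * (peak u c * g c)) = (\<Sum>c\<in>G. x u c * (peak u c * g c))"
    using fin by (intro sum.mono_neutral_right) (auto simp: peak_def G_iff)
  also have "\<dots> = (\<Sum>c\<in>G. gain u c * g c)"
    by (intro sum.cong refl) (simp add: assms x_peak flip: mult.assoc)
  also have "\<dots> = (\<Sum>c<k. gain u c * g c)"
    by (intro sum.mono_neutral_left) (auto simp: gain_def G_iff)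
  finally show ?thesis .
qed

lemma sum_single: "(\<Sum>u'\<in>S. if u' = u then peak u (f u') * h (f u') else (0::real)) = peak u (f u) * h (f u)"
  using fin by (cases "u \<in> S") (auto simp: peak_def)

lemma sum_single_x:
  "(\<Sum>u'\<in>S. \<Sum>c\<in>C. x u' c * (if u' = u then peak u c * g c else 0)) = (\<Sum>c<k. gain u c * g c)"
proof -
  have "(\<Sum>u'\<in>S. \<Sum>c\<in>C. x u' c * (if u' = u then peak u c * g c else 0))
      = (\<Sum>u'\<in>S. if u' = u then (\<Sum>c<k. gain u c * g c) else 0)"
    using sum_x_peak by (intro sum.cong) auto
  then show ?thesis using fin by (cases "u \<in> S") (auto simp: gain_def)
qed

text \<open>
  Because \<open>m\<close> is injective, the two subtracted terms never meet in the same color, so the product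
  of two weights depends on \<open>m\<close> affinely; its mean drops by the product of the gains.
\<close>

lemma affine_pair:
  assumes "u \<noteq> v"
  shows "\<exists>a w. (\<forall>m. inj_on m S \<and> m ` S \<subseteq> C \<longrightarrow>
             (\<Sum>c<k. reweight m u c * reweight m v c) - (\<Sum>c<k. M u c * M v c) = a + (\<Sum>u\<in>S. w u (m u))) \<and>
           a + (\<Sum>u\<in>S. \<Sum>c\<in>C. x u c * w u c) \<le> 0"
proof -
  define A where "A = (\<lambda>u c. M u c + gain u c)"
  define a where "a = (\<Sum>c<k. A u c * A v c - M u c * M v c)"
  define w where "w = (\<lambda>u' c. - (if u' = u then peak u c * A v c else 0) - (if u' = v then peak v c * A u c else 0))"
  have "(\<Sum>c<k. reweight m u c * reweight m v c) - (\<Sum>c<k. M u c * M v c) = a + (\<Sum>u\<in>S. w u (m u))"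
    if m: "inj_on m S" "m ` S \<subseteq> C" for m
  proof -
    let ?p = "\<lambda>u c. if m u = c then peak u c else 0"
    \<comment> \<open>Two neighbours cannot share a color because \<open>m\<close> is injective on
      \<open>S\<close>, and outside \<open>S\<close> the peak is 0.\<close>
    have disj: "?p u c * ?p v c = 0" for c
      using inj_onD[OF m(1), of u v] assms by (auto simp: peak_def)
    have "reweight m u c * reweight m v c = A u c * A v c - ?p u c * A v c - ?p v c * A u c" for c
      using disj[of c] unfolding reweight_def A_def by (simp only: algebra_simps)
    then have "(\<Sum>c<k. reweight m u c * reweight m v c) - (\<Sum>c<k. M u c * M v c)
      = a - (\<Sum>c<k. ?p u c * A v c) - (\<Sum>c<k. ?p v c * A u c)"
      by (simp add: a_def sum_subtractf)
    also have "\<dots> = a - peak u (m u) * A v (m u) - peak v (m v) * A u (m v)"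
      using m(2) by (subst (1 2) sum_peak) auto
    also have "\<dots> = a + (\<Sum>u\<in>S. w u (m u))"
      by (simp add: w_def sum_subtractf sum_negf sum_single)
    finally show ?thesis .
  qed
  moreover have "a + (\<Sum>u\<in>S. \<Sum>c\<in>C. x u c * w u c) \<le> 0"
  proof -
    have "(\<Sum>u\<in>S. \<Sum>c\<in>C. x u c * w u c) = - (\<Sum>c<k. gain u c * A v c) - (\<Sum>c<k. gain v c * A u c)"
      by (simp only: w_def right_diff_distrib mult_minus_right sum_subtractf sum_negf sum_single_x)
    then have "a + (\<Sum>u\<in>S. \<Sum>c\<in>C. x u c * w u c)
      = (\<Sum>c<k. A u c * A v c - M u c * M v c - gain u c * A v c - gain v c * A u c)"
      by (simp add: a_def sum_subtractf)
    also have "\<dots> = (\<Sum>c<k. - (gain u c * gain v c))"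
      by (intro sum.cong refl) (simp add: A_def algebra_simps)
    also have "\<dots> \<le> 0" by (intro sum_nonpos) (simp add: gain_nonneg)
    finally show ?thesis .
  qed
  ultimately show ?thesis by blast
qed

lemma affine_total:
  "\<exists>a w. (\<forall>m. inj_on m S \<and> m ` S \<subseteq> C \<longrightarrow>
             (\<Sum>c<k. M u c) - (\<Sum>c<k. reweight m u c) = a + (\<Sum>u\<in>S. w u (m u))) \<and>
           a + (\<Sum>u\<in>S. \<Sum>c\<in>C. x u c * w u c) \<le> 0"
proof -
  define a where "a = - (\<Sum>c<k. gain u c)"
  define w where "w = (\<lambda>u' c. if u' = u then peak u c * 1 else 0)"
  have "(\<Sum>c<k. M u c) - (\<Sum>c<k. reweight m u c) = a + (\<Sum>u\<in>S. w u (m u))"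
    if m: "inj_on m S" "m ` S \<subseteq> C" for m
  proof -
    have "(\<Sum>c<k. M u c) - (\<Sum>c<k. reweight m u c) = a + (\<Sum>c<k. (if m u = c then peak u c else 0) * 1)"
      by (simp add: reweight_def a_def sum.distrib sum_subtractf)
    also have "\<dots> = a + peak u (m u) * 1" using m(2) by (subst sum_peak) auto
    also have "\<dots> = a + (\<Sum>u\<in>S. w u (m u))"
      unfolding w_def by (subst sum_single) simp
    finally show ?thesis .
  qed
  moreover have "a + (\<Sum>u\<in>S. \<Sum>c\<in>C. x u c * w u c) \<le> 0"
    by (simp only: w_def sum_single_x a_def) simp
  ultimately show ?thesis by blast
qed

text \<open>An edge is wasted when it is matched to a dummy column, which has probability at most
  1/10; subtracting 1/10 makes the mean drift nonpositive.\<close>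

lemma affine_waste:
  assumes "\<And>u. u \<in> S \<Longrightarrow> (\<Sum>c\<in>C - G. x u c) \<le> 1 / 10"
  shows "\<exists>a w. (\<forall>m. inj_on m S \<and> m ` S \<subseteq> C \<longrightarrow>
             (if u \<in> S then of_bool (m u \<ge> k) - 1 / 10 else 0) = a + (\<Sum>u\<in>S. w u (m u))) \<and>
           a + (\<Sum>u\<in>S. \<Sum>c\<in>C. x u c * w u c) \<le> (0::real)"
proof (cases "u \<in> S")
  case True
  define w :: "nat \<Rightarrow> nat \<Rightarrow> real" where "w = (\<lambda>u' c. if u' = u then of_bool (c \<ge> k) else 0)"
  have "(\<Sum>u\<in>S. \<Sum>c\<in>C. x u c * w u c) = (\<Sum>u'\<in>S. if u' = u then (\<Sum>c\<in>C. x u c * of_bool (c \<ge> k)) else 0)"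
    by (intro sum.cong) (auto simp: w_def)
  also have "\<dots> = (\<Sum>c\<in>C. x u c * of_bool (c \<ge> k))" using True fin by simp
  also have "\<dots> = (\<Sum>c\<in>C - G. x u c * of_bool (c \<ge> k))"
    using fin by (intro sum.mono_neutral_right) (auto simp: G_iff)
  also have "\<dots> = (\<Sum>c\<in>C - G. x u c)" by (intro sum.cong) (auto simp: G_iff)
  finally have "- 1 / 10 + (\<Sum>u\<in>S. \<Sum>c\<in>C. x u c * w u c) \<le> 0" using assms[OF True] by simp
  moreover have "(if u \<in> S then of_bool (m u \<ge> k) - 1 / 10 else 0) = - 1 / 10 + (\<Sum>u\<in>S. w u (m u))" for m
    using True fin by (simp add: w_def)
  ultimately show ?thesis by blast
next
  case False
  then show ?thesis by (intro exI[of _ 0] exI[of _ "\<lambda>_ _. 0"]) simp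
qed

text \<open>At most \<open>k \<le> K\<close> colors gain at most \<open>50 / K\<close> each, and a
  single color can lose its peak, which is at most 6.\<close>

lemma variation:
  assumes "u \<in> S \<Longrightarrow> m u \<in> C"
  shows "(\<Sum>c<k. \<bar>reweight m u c - M u c\<bar>) \<le> 56"
proof -
  have "(\<Sum>c<k. \<bar>reweight m u c - M u c\<bar>) \<le> (\<Sum>c<k. 50 / K + (if m u = c then peak u c else 0) * 1)"
  proof (rule sum_mono)
    fix c
    show "\<bar>reweight m u c - M u c\<bar> \<le> 50 / K + (if m u = c then peak u c else 0) * 1"
      using gain_nonneg[of u c] gain_le[of u c] peak_bounds(1)[of u c] by (auto simp: reweight_def)
  qed
  also have "\<dots> = k * (50 / K) + peak u (m u) * 1"
    using assms by (subst sum.distrib, subst sum_peak) auto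
  also have "\<dots> \<le> 50 + 6"
    using K peak_bounds(2)[of u "m u"] by (intro add_mono) (auto simp: field_simps)
  finally show ?thesis by simp
qed

lemma total_change:
  assumes "u \<in> S \<Longrightarrow> m u \<in> C"
  shows "\<bar>(\<Sum>c<k. M u c) - (\<Sum>c<k. reweight m u c)\<bar> \<le> 1000"
proof -
  have "\<bar>(\<Sum>c<k. M u c) - (\<Sum>c<k. reweight m u c)\<bar> = \<bar>\<Sum>c<k. reweight m u c - M u c\<bar>"
    by (simp add: sum_subtractf)
  also have "\<dots> \<le> (\<Sum>c<k. \<bar>reweight m u c - M u c\<bar>)" by (rule sum_abs)
  finally show ?thesis using variation[of u m] assms by simp
qed

text \<open>The product rule, with weights at most 5 before and 6 after the arrival, gives
  \<open>56 * 6 + 5 * 56 = 616\<close>. The rounder 1000 serves as a common step bound for all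
  quantities.\<close>

lemma pair_change:
  assumes "u \<in> S \<Longrightarrow> m u \<in> C" "v \<in> S \<Longrightarrow> m v \<in> C"
  shows "\<bar>(\<Sum>c<k. reweight m u c * reweight m v c) - (\<Sum>c<k. M u c * M v c)\<bar> \<le> 1000"
proof -
  have "\<bar>(\<Sum>c<k. reweight m u c * reweight m v c) - (\<Sum>c<k. M u c * M v c)\<bar>
     = \<bar>\<Sum>c<k. (reweight m u c - M u c) * reweight m v c + M u c * (reweight m v c - M v c)\<bar>"
    by (simp add: sum_subtractf sum.distrib algebra_simps)
  also have "\<dots> \<le> (\<Sum>c<k. \<bar>(reweight m u c - M u c) * reweight m v c + M u c * (reweight m v c - M v c)\<bar>)"
    by (rule sum_abs)
  also have "\<dots> \<le> (\<Sum>c<k. \<bar>reweight m u c - M u c\<bar> * 6 + 5 * \<bar>reweight m v c - M v c\<bar>)"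
  proof (rule sum_mono)
    fix c
    have "\<bar>(reweight m u c - M u c) * reweight m v c\<bar> \<le> \<bar>reweight m u c - M u c\<bar> * 6"
      using reweight_bounds[of m v c] by (auto simp: abs_mult intro!: mult_left_mono)
    moreover have "\<bar>M u c * (reweight m v c - M v c)\<bar> \<le> 5 * \<bar>reweight m v c - M v c\<bar>"
      using M[of u c] by (auto simp: abs_mult intro!: mult_right_mono)
    ultimately show "\<bar>(reweight m u c - M u c) * reweight m v c + M u c * (reweight m v c - M v c)\<bar>
       \<le> \<bar>reweight m u c - M u c\<bar> * 6 + 5 * \<bar>reweight m v c - M v c\<bar>" by linarith
  qed
  also have "\<dots> = (\<Sum>c<k. \<bar>reweight m u c - M u c\<bar>) * 6 + 5 * (\<Sum>c<k. \<bar>reweight m v c - M v c\<bar>)"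
    by (simp add: sum.distrib sum_distrib_left sum_distrib_right)
  also have "\<dots> \<le> 1000" using variation[of u m, OF assms(1)] variation[of v m, OF assms(2)] by simp
  finally show ?thesis .
qed

text \<open>A weight that survives satisfies \<open>1 / M' = 1 / M - 1 / K\<close>.\<close>

lemma reweight_cap:
  assumes "M u c * (K - d) \<le> K" "d' = d + of_bool (u \<in> S)"
  shows "reweight m u c * (K - d') \<le> K"
proof (cases "u \<in> S \<and> c \<in> G \<and> m u \<noteq> c")
  case True
  \<comment> \<open>The cap reads \<open>1 / M u c \<ge> 1 - d / K\<close> without denominators, a
    form that also covers weight 0.\<close>
  have "M u c * (K - (d + 1)) \<le> K - M u c" using assms(1) by (simp add: algebra_simps)
  then have "M u c * (K - (d + 1)) / (K - M u c) \<le> 1" using weight_less_K[of u c] by (simp add: field_simps)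
  then have "K * (M u c * (K - (d + 1)) / (K - M u c)) \<le> K * 1" using K by (intro mult_left_mono) auto
  moreover have "reweight m u c = M u c * K / (K - M u c)"
    using True peak_eq[of u c] by (simp add: reweight_def peak_def)
  ultimately show ?thesis using True assms(2) by (simp add: algebra_simps)
next
  case False
  show ?thesis
  proof (cases "u \<in> S \<and> c \<in> G")
    case True
    then have "reweight m u c = 0" using False by (simp add: reweight_def peak_def)
    then show ?thesis using K by simp
  next
    case False
    then have "reweight m u c = M u c" by (auto simp: reweight_def peak_def gain_def)
    moreover have "M u c * (K - d') \<le> M u c * (K - d)"
      using M(1)[of u c] assms(2) by (intro mult_left_mono) auto
    ultimately show ?thesis using assms(1) by simp
  qed
qed

end

section \<open>The invariant\<close>

text \<open>Overlaps and deficits feed the second moment bound on overloaded colors; waste controls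
  how much of the extra palette is occupied at a node.\<close>

datatype quantity = Overlap nat nat | Deficit nat | Waste nat

text \<open>The extra palette \<open>{k..<q}\<close> has at least \<open>\<Delta> / 4 - 2\<close>
  colors. \<open>K\<close> is the largest total weight the invariant permits, so the demands of a
  node sum to at most 1. By \<open>budget\<close>, a term at level above \<open>k / 2500\<close>
  would exceed the bound on the potential even at the maximal age
  \<open>2 * \<Delta>\<close>.\<close>

locale palette =
  fixes n \<Delta> k q :: nat and K l :: real
  assumes \<Delta>: "\<Delta> \<ge> 1000000"
    and k: "5 / 4 * real \<Delta> \<le> real k" "real k \<le> 5 / 4 * real \<Delta> + 1"
    and q: "real k + real \<Delta> / 4 - 2 \<le> real q"
    and K: "K = real k * (1 + 1 / 2500)"
    and l: "l > 0" "l * 1000 \<le> 1"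
    and budget: "real (n\<^sup>2 + 3 * n) \<le> exp (l * (real k / 2500) - (l * 1000)\<^sup>2 * (2 * real \<Delta>))"
begin

text \<open>
  The number \<open>n\<close> is a phantom offline node whose weights stay 1, so that \<open>Overlap u n\<close> bounds the
  total weight of \<open>u\<close> from above. \<open>U u\<close> is the set of colors used at \<open>u\<close>; those from \<open>k\<close> on
  belong to wasted edges.
\<close>

definition quantities :: "quantity set" where
  "quantities = (\<lambda>(u, v). Overlap u v) ` {(u, v). u \<le> n \<and> v \<le> n \<and> u \<noteq> v} \<union> Deficit ` {..<n} \<union> Waste ` {..<n}"

fun level :: "(nat \<Rightarrow> nat \<Rightarrow> real) \<Rightarrow> (nat \<Rightarrow> nat set) \<Rightarrow> quantity \<Rightarrow> real" where
  "level M U (Overlap u v) = (\<Sum>c<k. M u c * M v c) - real k"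
| "level M U (Deficit u) = real k - (\<Sum>c<k. M u c)"
| "level M U (Waste u) = real (card (U u \<inter> {k..})) - real (card (U u)) / 10"

text \<open>The number of colors used at a node counts the arrivals adjacent to it, and only these
  can change a level. An arrival adjacent to both nodes of an overlap counts twice.\<close>

fun age :: "(nat \<Rightarrow> nat set) \<Rightarrow> quantity \<Rightarrow> real" where
  "age U (Overlap u v) = real (card (U u)) + real (card (U v))"
| "age U (Deficit u) = real (card (U u))"
| "age U (Waste u) = real (card (U u))"

definition potential :: "(nat \<Rightarrow> nat \<Rightarrow> real) \<Rightarrow> (nat \<Rightarrow> nat set) \<Rightarrow> real" where
  "potential M U = (\<Sum>i\<in>quantities. exp (l * level M U i - (l * 1000)\<^sup>2 * age U i))"

text \<open>The clause with \<open>K - real (card (U u))\<close> is the cap that keeps weights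
  bounded as degrees grow. Used main colors have weight 0, so a positive weight certifies that a
  main color is free.\<close>

definition admissible :: "(nat \<Rightarrow> nat \<Rightarrow> real) \<Rightarrow> (nat \<Rightarrow> nat set) \<Rightarrow> bool" where
  "admissible M U \<longleftrightarrow>
     (\<forall>u. U u \<subseteq> {..<q} \<and> card (U u) \<le> \<Delta>) \<and> U n = {} \<and> (\<forall>c. M n c = 1) \<and>
     (\<forall>u c. 0 \<le> M u c \<and> M u c * (K - real (card (U u))) \<le> K) \<and>
     (\<forall>u c. c \<in> U u \<and> c < k \<longrightarrow> M u c = 0) \<and>
     potential M U \<le> real (n\<^sup>2 + 3 * n)"

lemma finite_quantities: "finite quantities"
proof -
  have "finite {(u, v). u \<le> n \<and> v \<le> n \<and> u \<noteq> v}"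
    by (rule finite_subset[of _ "{..n} \<times> {..n}"]) auto
  then show ?thesis by (simp add: quantities_def)
qed

lemma card_quantities: "card quantities \<le> n\<^sup>2 + 3 * n"
proof -
  have eq: "{(u, v). u \<le> n \<and> v \<le> n \<and> u \<noteq> v} = {..n} \<times> {..n} - (\<lambda>u. (u, u)) ` {..n}" by auto
  have "card {(u, v). u \<le> n \<and> v \<le> n \<and> u \<noteq> v} = (n + 1) * (n + 1) - (n + 1)"
    unfolding eq by (subst card_Diff_subset) (auto simp: card_image inj_on_def card_cartesian_product)
  also have "\<dots> = n\<^sup>2 + n" by (simp add: power2_eq_square algebra_simps)
  finally have P: "card {(u, v). u \<le> n \<and> v \<le> n \<and> u \<noteq> v} = n\<^sup>2 + n" .
  have fin: "finite {(u, v). u \<le> n \<and> v \<le> n \<and> u \<noteq> v}" unfolding eq by simp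
  have "card quantities \<le> card ((\<lambda>(u, v). Overlap u v) ` {(u, v). u \<le> n \<and> v \<le> n \<and> u \<noteq> v})
      + card (Deficit ` {..<n}) + card (Waste ` {..<n})"
    unfolding quantities_def by (intro order_trans[OF card_Un_le] add_right_mono card_Un_le)
  also have "\<dots> \<le> (n\<^sup>2 + n) + n + n"
    using card_image_le[OF fin, of "\<lambda>(u, v). Overlap u v"] card_image_le[of "{..<n}" Deficit]
      card_image_le[of "{..<n}" Waste] P by simp
  finally show ?thesis by simp
qed

lemma K_bounds: "K \<ge> 1000000" "real k \<le> K" "5 / 4 * real \<Delta> \<le> K"
  using \<Delta> k unfolding K by (auto simp: algebra_simps)

lemma admissible_init: "admissible (\<lambda>_ _. 1) (\<lambda>_. {})"
proof -
  have "level (\<lambda>_ _. 1) (\<lambda>_. {}) i = 0" "age (\<lambda>_. {}) i = 0" for i by (cases i; simp)+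
  then have "potential (\<lambda>_ _. 1) (\<lambda>_. {}) = card quantities" by (simp add: potential_def)
  also have "\<dots> \<le> real (n\<^sup>2 + 3 * n)" using card_quantities by (simp only: of_nat_le_iff)
  finally show ?thesis using K_bounds by (simp add: admissible_def)
qed

text \<open>A single term of the potential is at most \<open>n\<^sup>2 + 3 * n\<close>, which
  \<open>budget\<close> compares with a term of level \<open>k / 2500\<close> at the largest
  age.\<close>

lemma level_le:
  assumes adm: "admissible M U" and i: "i \<in> quantities"
  shows "level M U i \<le> real k / 2500"
proof -
  have deg: "real (card (U u)) \<le> real \<Delta>" for u using adm by (simp add: admissible_def)
  have age: "age U i \<le> 2 * real \<Delta>"
  proof (cases i)
    case (Overlap u v)
    then show ?thesis using deg[of u] deg[of v] by simp
  next
    case (Deficit u)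
    then show ?thesis using deg[of u] by simp
  next
    case (Waste u)
    then show ?thesis using deg[of u] by simp
  qed
  have "exp (l * level M U i - (l * 1000)\<^sup>2 * age U i) \<le> potential M U"
    unfolding potential_def using i finite_quantities by (intro member_le_sum) auto
  also have "\<dots> \<le> real (n\<^sup>2 + 3 * n)" using adm unfolding admissible_def by blast
  also note budget
  finally have "l * level M U i - (l * 1000)\<^sup>2 * age U i \<le> l * (real k / 2500) - (l * 1000)\<^sup>2 * (2 * real \<Delta>)" by simp
  moreover have "(l * 1000)\<^sup>2 * age U i \<le> (l * 1000)\<^sup>2 * (2 * real \<Delta>)" using age by (intro mult_left_mono) auto
  ultimately have "l * level M U i \<le> l * (real k / 2500)" by linarith
  then show ?thesis using l by simp
qed

text \<open>With at least \<open>5 / 4 * \<Delta>\<close> main colors,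
  \<open>\<Delta> \<le> 4 / 5 * K\<close>, so \<open>K - real (card (U u))\<close> never falls below
  \<open>K / 5\<close>.\<close>

lemma weight_le_5:
  assumes "admissible M U"
  shows "M u c \<le> 5"
proof -
  have "real (card (U u)) \<le> real \<Delta>" "0 \<le> M u c" "M u c * (K - real (card (U u))) \<le> K"
    using assms by (auto simp: admissible_def)
  moreover from this have "M u c * (K / 5) \<le> M u c * (K - real (card (U u)))"
    using K_bounds by (intro mult_left_mono) auto
  ultimately have "M u c * (K / 5) \<le> 5 * (K / 5)" by simp
  then show ?thesis using K_bounds by (subst (asm) mult_le_cancel_right) auto
qed

text \<open>Loads concentrate around \<open>s \<le> 4 / 5 * K\<close>, so an overloaded color
  deviates by at least \<open>K / 5\<close>. Few such colors exist, and each holds weight at most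
  5.\<close>

lemma good_mass:
  assumes adm: "admissible M U" and S: "S \<subseteq> {..<n}" "card S \<le> \<Delta>" and u: "u \<in> S"
  shows "(\<Sum>c\<in>{c. c < k \<and> (\<Sum>u\<in>S. M u c) \<le> K}. M u c) \<ge> 9 / 10 * K"
proof -
  have fin: "finite S" using S finite_subset by blast
  define s where "s = real (card S)"
  define bad where "bad = {c \<in> {..<k}. (\<Sum>u\<in>S. M u c) > K}"
  have s: "0 \<le> s" "s \<le> 4 / 5 * K" using S K_bounds by (auto simp: s_def)
  have lower: "(\<Sum>c<k. M v c) \<ge> real k * (1 - 1 / 2500)" if "v \<in> S" for v
    using level_le[OF adm, of "Deficit v"] that S by (auto simp: quantities_def algebra_simps)
  have "real (card bad) * (K - s)\<^sup>2 \<le> real (card {..<k}) * (3 * (1 / 2500) * (real (card S))\<^sup>2 + 5\<^sup>2 * real (card S))"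
    unfolding bad_def s_def
  proof (rule card_overloaded_le)
    show "0 \<le> M u c \<and> M u c \<le> 5" for u c using adm weight_le_5[OF adm] by (auto simp: admissible_def)
    fix v v' assume v: "v \<in> S" "v' \<in> S" "v \<noteq> v'"
    then have "Overlap v v' \<in> quantities" using S by (force simp: quantities_def)
    from level_le[OF adm this]
    show "(\<Sum>c<k. M v c * M v' c) \<le> real (card {..<k}) * (1 + 1 / 2500)" by (simp add: algebra_simps)
  qed (use lower s K_bounds fin in \<open>auto simp: s_def\<close>)
  also have "\<dots> \<le> K * (3 * (1 / 2500) * (4 / 5 * K)\<^sup>2 + 5\<^sup>2 * (4 / 5 * K))"
    using s K_bounds unfolding s_def[symmetric] by (intro mult_mono add_mono power_mono) (auto simp: s_def)
  finally have up: "real (card bad) * (K - s)\<^sup>2 \<le> K\<^sup>2 * (48 / 62500 * K + 20)"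
    by (simp add: power2_eq_square algebra_simps)
  have "real (card bad) * (K / 5)\<^sup>2 \<le> real (card bad) * (K - s)\<^sup>2"
    using s K_bounds by (intro mult_left_mono power_mono) auto
  with up have "K\<^sup>2 * (real (card bad) / 25) \<le> K\<^sup>2 * (48 / 62500 * K + 20)"
    by (simp add: power2_eq_square algebra_simps)
  then have cb: "real (card bad) \<le> 48 / 2500 * K + 500" using K_bounds by (subst (asm) mult_le_cancel_left) auto
  have "(\<Sum>c<k. M u c) = (\<Sum>c\<in>bad. M u c) + (\<Sum>c\<in>{..<k} - bad. M u c)"
    by (subst sum.subset_diff[of bad]) (auto simp: bad_def)
  also have "{..<k} - bad = {c. c < k \<and> (\<Sum>u\<in>S. M u c) \<le> K}" by (auto simp: bad_def)
  also have "(\<Sum>c\<in>bad. M u c) \<le> (\<Sum>c\<in>bad. 5)" by (intro sum_mono weight_le_5[OF adm])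
  finally have "real k * (1 - 1 / 2500) - 5 * card bad \<le> (\<Sum>c\<in>{c. c < k \<and> (\<Sum>u\<in>S. M u c) \<le> K}. M u c)"
    using lower[OF u] by simp
  moreover have "real k = K / (1 + 1 / 2500)" using K by simp
  \<comment> \<open>The overloaded colors cost at most
    \<open>5 * (48 / 2500 * K + 500) \<le> 0.0985 * K\<close>, as \<open>K \<ge> 1000000\<close>,
    while the total weight is at least \<open>0.9992 * K\<close>.\<close>
  ultimately show ?thesis using cb K_bounds(1) by (simp add: field_simps)
qed

text \<open>The increment of \<open>level\<close>, written in terms of \<open>m\<close>, before the
  wasted edges have received their actual colors.\<close>

definition drift :: "(nat \<Rightarrow> nat \<Rightarrow> real) \<Rightarrow> (nat \<Rightarrow> nat \<Rightarrow> real) \<Rightarrow> nat set \<Rightarrow> (nat \<Rightarrow> nat) \<Rightarrow> quantity \<Rightarrow> real" where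
  "drift M M' S m i = (case i of
       Overlap u v \<Rightarrow> (\<Sum>c<k. M' u c * M' v c) - (\<Sum>c<k. M u c * M v c)
     | Deficit u \<Rightarrow> (\<Sum>c<k. M u c) - (\<Sum>c<k. M' u c)
     | Waste u \<Rightarrow> (if u \<in> S then of_bool (m u \<ge> k) - 1 / 10 else 0))"

text \<open>Node \<open>u\<close> spreads \<open>M u c / K\<close> over the colors of
  \<open>G\<close> and its missing mass \<open>p u \<le> 1 / 10\<close> over \<open>D\<close> dummy
  columns, which gives a fractional matching saturating \<open>S\<close>. All drifts are affine with
  mean at most 0, so rounding applies.\<close>

lemma rounded_arrival:
  assumes adm: "admissible M U" and S: "S \<subseteq> {..<n}" "card S \<le> \<Delta>"
    and G_def: "G = {c. c < k \<and> (\<Sum>u\<in>S. M u c) \<le> K}"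
  obtains C x D m where
    "reweighting K k S G C M x" "C \<subseteq> {..<k + D}"
    "real D \<le> real \<Delta> / 10 + 1"
    "inj_on m S" "m ` S \<subseteq> C"
    "\<forall>u\<in>S. m u < k \<longrightarrow> M u (m u) > 0"
    "(\<Sum>i\<in>quantities. exp (l * level M U i - (l * 1000)\<^sup>2 * age U i) *
       drift M (reweighting.reweight K S G M m) S m i) \<le> 0"
proof -
  have fin: "finite S" using S finite_subset by blast
  have M0: "0 \<le> M u c" for u c using adm by (simp add: admissible_def)
  have K0: "K > 0" using K_bounds by linarith
  have finG: "finite G" by (simp add: G_def)
  define p where "p = (\<lambda>u. 1 - (\<Sum>c\<in>G. M u c) / K)"
  have p: "0 \<le> p u" "p u \<le> 1 / 10" if "u \<in> S" for u
  proof -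
    have "n \<noteq> u" "u < n" using S that by auto
    \<comment> \<open>The overlap with the phantom node bounds the total weight of \<open>u\<close>
      by \<open>k * (1 + 1 / 2500) = K\<close>.\<close>
    then have "Overlap u n \<in> quantities" by (force simp: quantities_def)
    moreover have "M n c = 1" for c using adm by (simp add: admissible_def)
    ultimately have "(\<Sum>c<k. M u c) \<le> K"
      using level_le[OF adm, of "Overlap u n"] by (simp add: K algebra_simps)
    moreover have "(\<Sum>c\<in>G. M u c) \<le> (\<Sum>c<k. M u c)" using M0 by (intro sum_mono2) (auto simp: G_def)
    ultimately show "0 \<le> p u" using K0 by (simp add: p_def)
    show "p u \<le> 1 / 10" using good_mass[OF adm S that] K0 by (simp add: p_def G_def field_simps)
  qed
  \<comment> \<open>Enough columns for the missing mass of all neighbours; the \<open>+ 1\<close>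
    makes up for rounding down and keeps \<open>D\<close> positive for the division in
    \<open>x\<close>.\<close>
  define D where "D = nat \<lfloor>\<Sum>u\<in>S. p u\<rfloor> + 1"
  have sp: "0 \<le> (\<Sum>u\<in>S. p u)" "(\<Sum>u\<in>S. p u) \<le> real \<Delta> / 10"
  proof -
    show "0 \<le> (\<Sum>u\<in>S. p u)" using p by (intro sum_nonneg) auto
    have "(\<Sum>u\<in>S. p u) \<le> (\<Sum>u\<in>S. 1 / 10)" using p by (intro sum_mono) auto
    also have "\<dots> \<le> real \<Delta> / 10" using S by simp
    finally show "(\<Sum>u\<in>S. p u) \<le> real \<Delta> / 10" .
  qed
  have D: "(\<Sum>u\<in>S. p u) \<le> real D" "real D \<le> real \<Delta> / 10 + 1" "D > 0"
    using sp unfolding D_def by linarith+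
  define C where "C = G \<union> {k..<k + D}"
  define x where "x = (\<lambda>u c. if c < k then M u c / K else p u / D)"
  have disj: "G \<inter> {k..<k + D} = {}" by (auto simp: G_def)
  have finC: "finite C" using finG by (simp add: C_def)
  have sumD: "(\<Sum>c\<in>{k..<k + D}. x u c) = p u" for u using D(3) by (simp add: x_def)
  interpret R: reweighting K k S G C M x
    using K_bounds fin finC M0 weight_le_5[OF adm]
    by unfold_locales (auto simp: C_def G_def x_def)
  have "\<exists>m. inj_on m S \<and> m ` S \<subseteq> C \<and> (\<forall>u\<in>S. x u (m u) > 0) \<and>
     (\<Sum>i\<in>quantities. exp (l * level M U i - (l * 1000)\<^sup>2 * age U i) *
       drift M (R.reweight m) S m i) \<le> 0"
  proof (rule affine_matching_rounding[OF fin finC finite_quantities])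
    show "x u c \<ge> 0" if "u \<in> S" "c \<in> C" for u c using that M0 K0 p by (simp add: x_def)
    show "(\<Sum>c\<in>C. x u c) = 1" if "u \<in> S" for u
    proof -
      have "(\<Sum>c\<in>C. x u c) = (\<Sum>c\<in>G. x u c) + p u"
        unfolding C_def using finG disj by (subst sum.union_disjoint) (auto simp: sumD)
      also have "(\<Sum>c\<in>G. x u c) = (\<Sum>c\<in>G. M u c) / K"
        by (simp add: x_def G_def sum_divide_distrib)
      finally show ?thesis by (simp add: p_def)
    qed
    show "(\<Sum>u\<in>S. x u c) \<le> 1" if "c \<in> C" for c
    proof (cases "c < k")
      case True
      then have "c \<in> G" using that by (simp add: C_def)
      then show ?thesis using True K0 by (simp add: x_def G_def flip: sum_divide_distrib)
    next
      case False
      then show ?thesis using D by (simp add: x_def flip: sum_divide_distrib)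
    qed
    fix i assume i: "i \<in> quantities"
    show "\<exists>a w. (\<forall>m. inj_on m S \<and> m ` S \<subseteq> C \<longrightarrow> drift M (R.reweight m) S m i = a + (\<Sum>u\<in>S. w u (m u))) \<and>
           a + (\<Sum>u\<in>S. \<Sum>c\<in>C. x u c * w u c) \<le> 0"
    proof (cases i)
      case (Overlap u v)
      then have "u \<noteq> v" using i by (auto simp: quantities_def)
      from R.affine_pair[OF this] show ?thesis unfolding drift_def Overlap quantity.case .
    next
      case (Deficit u)
      from R.affine_total[of u] show ?thesis unfolding drift_def Deficit quantity.case .
    next
      case (Waste u)
      have "C - G = {k..<k + D}" using disj by (auto simp: C_def)
      then have "(\<Sum>c\<in>C - G. x u c) \<le> 1 / 10" if "u \<in> S" for u using p(2)[OF that] by (simp add: sumD)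
      from R.affine_waste[OF this, of u] show ?thesis unfolding drift_def Waste quantity.case by simp
    qed
  qed simp
  then obtain m where m: "inj_on m S" "m ` S \<subseteq> C" "\<forall>u\<in>S. x u (m u) > 0"
    "(\<Sum>i\<in>quantities. exp (l * level M U i - (l * 1000)\<^sup>2 * age U i) *
       drift M (R.reweight m) S m i) \<le> 0" by blast
  have "M u (m u) > 0" if "u \<in> S" "m u < k" for u
    using m(3) that K0 by (auto simp: x_def zero_less_divide_iff)
  moreover have "C \<subseteq> {..<k + D}" by (auto simp: C_def G_def)
  ultimately show ?thesis using that[OF R.reweighting_axioms _ D(2) m(1,2) _ m(4)] by blast
qed

text \<open>Main colors come directly from the rounded matching; edges matched to dummy columns are
  recolored from the extra palette. The potential does not grow because its first-order change is
  nonpositive.\<close>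

lemma admissible_step:
  assumes adm: "admissible M U" and S: "S \<subseteq> {..<n}" "card S \<le> \<Delta>"
    and deg: "\<And>u. u \<in> S \<Longrightarrow> card (U u) < \<Delta>"
  shows "\<exists>f M'. inj_on f S \<and> f ` S \<subseteq> {..<q} \<and> (\<forall>u\<in>S. f u \<notin> U u) \<and>
           admissible M' (\<lambda>u. if u \<in> S then insert (f u) (U u) else U u)"
proof -
  define G where "G = {c. c < k \<and> (\<Sum>u\<in>S. M u c) \<le> K}"
  obtain C x D m where R: "reweighting K k S G C M x" and CD: "C \<subseteq> {..<k + D}"
    and D: "real D \<le> real \<Delta> / 10 + 1"
    and m: "inj_on m S" "m ` S \<subseteq> C" "\<forall>u\<in>S. m u < k \<longrightarrow> M u (m u) > 0"
    and lin: "(\<Sum>i\<in>quantities. exp (l * level M U i - (l * 1000)\<^sup>2 * age U i) *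
       drift M (reweighting.reweight K S G M m) S m i) \<le> 0"
    by (rule rounded_arrival[OF adm S G_def])
  interpret R: reweighting K k S G C M x by (rule R)
  have fin: "finite S" using S finite_subset by blast
  have Uq: "U u \<subseteq> {..<q}" and finU: "finite (U u)" and cU: "card (U u) \<le> \<Delta>" for u
    using adm by (auto simp: admissible_def intro: finite_subset)
  have kq: "k \<le> q" using q \<Delta> by linarith
  define T where "T = {u \<in> S. m u \<ge> k}"
  \<comment> \<open>In effect a greedy choice: at most \<open>D \<le> \<Delta> / 10 + 1\<close>
    edges are wasted now, and about \<open>\<Delta> / 10\<close> extra colors may be occupied at
    \<open>u\<close>. Of the \<open>\<Delta> / 4 - 2\<close> available, at least \<open>D\<close>
    stay free, so one node already supplies Hall's bound.\<close>
  have "\<exists>h. inj_on h T \<and> (\<forall>u\<in>T. h u \<in> {k..<q} - U u)"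
  proof (rule Hall_marriage)
    fix J assume J: "J \<subseteq> T"
    show "card J \<le> card (\<Union>u\<in>J. {k..<q} - U u)"
    proof (cases "J = {}")
      case False
      then obtain u where u: "u \<in> J" by blast
      have "card J \<le> card T" using J fin by (intro card_mono) (auto simp: T_def)
      also have "card T = card (m ` T)" using m(1) by (subst card_image) (auto simp: T_def inj_on_def)
      also have "\<dots> \<le> card {k..<k + D}" using order_trans[OF m(2) CD] by (intro card_mono) (auto simp: T_def)
      finally have "card J \<le> D" by simp
      have "u \<in> S" using u J by (auto simp: T_def)
      then have "Waste u \<in> quantities" using S by (auto simp: quantities_def)
      from level_le[OF adm this] have "real (card (U u \<inter> {k..})) \<le> real \<Delta> / 10 + real k / 2500"
        using cU[of u] by simp
      moreover have "card ({k..<q} - U u) = card {k..<q} - card ({k..<q} \<inter> U u)"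
        using finU by (intro card_Diff_subset_Int) auto
      moreover have "{k..<q} \<inter> U u = U u \<inter> {k..}" using Uq[of u] by auto
      ultimately have "real D \<le> real (card ({k..<q} - U u))"
        using D q k \<Delta> by simp
      also have "\<dots> \<le> real (card (\<Union>u\<in>J. {k..<q} - U u))"
        using u J fin by (intro of_nat_mono card_mono) (auto simp: T_def intro: finite_subset)
      finally show ?thesis using \<open>card J \<le> D\<close> by simp
    qed simp
  qed (use fin in \<open>auto simp: T_def\<close>)
  then obtain h where h: "inj_on h T" "\<And>u. u \<in> T \<Longrightarrow> h u \<in> {k..<q} - U u" by blast
  define f where "f = (\<lambda>u. if m u < k then m u else h u)"
  define U' where "U' = (\<lambda>u. if u \<in> S then insert (f u) (U u) else U u)"
  define M' where "M' = R.reweight m"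
  have zero: "M u c = 0" if "c \<in> U u" "c < k" for u c using adm that unfolding admissible_def by blast
  have hT: "k \<le> h u" "h u < q" "h u \<notin> U u" if "u \<in> S" "\<not> m u < k" for u
    using h(2)[of u] that by (auto simp: T_def)
  \<comment> \<open>Dummy columns and the extra colors replacing them both lie in
    \<open>{k..}\<close>, so the waste counted through \<open>U'\<close> is the one predicted by
    \<open>m\<close>.\<close>
  have f_ge: "f u \<ge> k \<longleftrightarrow> m u \<ge> k" if "u \<in> S" for u using hT[of u] that by (auto simp: f_def)
  have f_new: "f u \<notin> U u" if "u \<in> S" for u
    using hT[of u] zero[of "m u" u] m(3) that by (auto simp: f_def)
  have f_inj: "inj_on f S"
  proof (rule inj_onI)
    fix a b assume ab: "a \<in> S" "b \<in> S" "f a = f b"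
    show "a = b"
      using ab hT[of a] hT[of b] inj_onD[OF m(1), of a b] inj_onD[OF h(1), of a b]
      by (auto simp: f_def T_def not_less split: if_splits)
  qed
  have f_q: "f ` S \<subseteq> {..<q}" using hT kq by (auto simp: f_def)
  have card': "card (U' u) = card (U u) + of_bool (u \<in> S)" for u
    using f_new finU by (simp add: U'_def)
  have waste': "card (U' u \<inter> {k..}) = card (U u \<inter> {k..}) + of_bool (u \<in> S \<and> m u \<ge> k)" for u
    using f_new[of u] f_ge[of u] finU[of u] by (auto simp: U'_def Int_insert_left)
  have stable: "M' u = M u" if "u \<notin> S" for u
    using that by (auto simp: M'_def R.reweight_def R.gain_def R.peak_def)
  have nS: "n \<notin> S" using S by auto
  have diff: "level M' U' i - level M U i = drift M M' S m i" for i
    by (cases i) (auto simp: drift_def waste' card' field_simps)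
  have mC: "u \<in> S \<Longrightarrow> m u \<in> C" for u using m(2) by blast
  have "potential M' U' \<le> potential M U"
    unfolding potential_def
  proof (rule exponential_potential_step)
    show "(\<Sum>i\<in>quantities. exp (l * level M U i - (l * 1000)\<^sup>2 * age U i) * (level M' U' i - level M U i)) \<le> 0"
      using lin unfolding diff unfolding M'_def .
    fix i assume "i \<in> quantities"
    show "\<bar>level M' U' i - level M U i\<bar> \<le> 1000"
    proof (cases i)
      case (Overlap u v)
      then show ?thesis using R.pair_change[of u m v] mC by (simp add: diff drift_def M'_def)
    next
      case (Deficit u)
      then show ?thesis using R.total_change[of u m] mC by (simp add: diff drift_def M'_def)
    next
      case (Waste u)
      then show ?thesis unfolding diff by (simp add: drift_def)
    qed
    show "age U' i \<ge> age U i + 1 \<or> (age U' i = age U i \<and> level M' U' i = level M U i)"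
    proof (cases i)
      case (Overlap u v)
      then show ?thesis by (cases "u \<in> S"; cases "v \<in> S") (auto simp: card' stable)
    next
      case (Deficit u)
      then show ?thesis by (cases "u \<in> S") (auto simp: card' stable)
    next
      case (Waste u)
      then show ?thesis by (cases "u \<in> S") (auto simp: card' waste')
    qed
  qed (use finite_quantities l in auto)
  also have "\<dots> \<le> real (n\<^sup>2 + 3 * n)" using adm unfolding admissible_def by blast
  finally have pot: "potential M' U' \<le> real (n\<^sup>2 + 3 * n)" .
  have "admissible M' U'"
    unfolding admissible_def
  proof (intro conjI allI impI)
    show "U' u \<subseteq> {..<q}" for u using Uq[of u] f_q by (auto simp: U'_def)
    show "card (U' u) \<le> \<Delta>" for u using deg[of u] cU[of u] by (auto simp: card')
    show "U' n = {}" using nS adm by (simp add: U'_def admissible_def)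
    show "M' n c = 1" for c using stable[OF nS] adm by (simp add: admissible_def)
    show "0 \<le> M' u c" for u c unfolding M'_def by (rule R.reweight_bounds)
    show "M' u c * (K - real (card (U' u))) \<le> K" for u c
      unfolding M'_def using adm
      by (intro R.reweight_cap[where d = "real (card (U u))"]) (auto simp: card' admissible_def)
    show "M' u c = 0" if "c \<in> U' u \<and> c < k" for u c
    proof (cases "c \<in> U u")
      case True
      then have "M u c = 0" using zero that by blast
      then show ?thesis by (simp add: M'_def R.reweight_def R.gain_def R.peak_def)
    next
      case False
      then have u: "u \<in> S" "c = f u" using that by (auto simp: U'_def split: if_splits)
      then have "c = m u" using that hT[of u] by (auto simp: f_def split: if_splits)
      moreover from this have "c \<in> G" using that mC u R.G_iff by blast
      ultimately show ?thesis using u by (simp add: M'_def R.reweight_def R.peak_def)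
    qed
    show "potential M' U' \<le> real (n\<^sup>2 + 3 * n)" by (rule pot)
  qed
  then show ?thesis using f_inj f_q f_new unfolding U'_def by blast
qed

end

section \<open>From strategies to online algorithms\<close>

lemma offline_degree_eq: "offline_degree N u = card {t. t < length N \<and> u \<in> N ! t}"
proof -
  have "{e \<in> edges N. fst e = u} = Pair u ` {t. t < length N \<and> u \<in> N ! t}"
    by (auto simp: edges_def)
  then show ?thesis by (simp add: offline_degree_def card_image inj_on_def)
qed

lemma online_degree_eq:
  assumes "t < length N"
  shows "online_degree N t = card (N ! t)"
proof -
  have "{e \<in> edges N. snd e = t} = (\<lambda>u. (u, t)) ` (N ! t)"
    using assms by (auto simp: edges_def)
  then show ?thesis by (simp add: online_degree_def card_image inj_on_def)
qed

lemma inputs_bounds: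
  assumes "N \<in> inputs n \<Delta>"
  shows "length N = n" "t < n \<Longrightarrow> N ! t \<subseteq> {..<n}" "t < n \<Longrightarrow> card (N ! t) \<le> \<Delta>"
    "u < n \<Longrightarrow> card {t. t < n \<and> u \<in> N ! t} \<le> \<Delta>"
proof -
  show len: "length N = n" using assms by (simp add: inputs_def)
  show "N ! t \<subseteq> {..<n}" if "t < n" using assms that by (auto simp: inputs_def)
  have md: "max_degree n N = \<Delta>" using assms by (simp add: inputs_def)
  have "online_degree N t \<le> max_degree n N" if "t < n"
    unfolding max_degree_def using that by (intro Max_ge) auto
  then show "card (N ! t) \<le> \<Delta>" if "t < n" using that md len by (simp add: online_degree_eq)
  have "offline_degree N u \<le> max_degree n N" if "u < n"
    unfolding max_degree_def using that by (intro Max_ge) auto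
  then show "card {t. t < n \<and> u \<in> N ! t} \<le> \<Delta>" if "u < n"
    using that md len by (simp add: offline_degree_eq)
qed

text \<open>\<open>SOME\<close> makes each choice a function of \<open>U\<close> and the new
  neighbourhood, so the used colors can be recomputed by replaying the past arrivals. This turns a
  stepwise strategy into a function of the revealed prefix.\<close>

lemma online_strategy:
  fixes Inv :: "(nat \<Rightarrow> nat set) \<Rightarrow> bool"
  assumes init: "Inv (\<lambda>_. {})"
    and step: "\<And>U S. Inv U \<Longrightarrow> S \<subseteq> {..<n} \<Longrightarrow> card S \<le> \<Delta> \<Longrightarrow> (\<And>u. u \<in> S \<Longrightarrow> card (U u) < \<Delta>) \<Longrightarrow>
        \<exists>f. inj_on f S \<and> f ` S \<subseteq> {..<q} \<and> (\<forall>u\<in>S. f u \<notin> U u) \<and>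
            Inv (\<lambda>u. if u \<in> S then insert (f u) (U u) else U u)"
  shows "\<exists>a :: arrivals \<Rightarrow> nat \<Rightarrow> nat. \<forall>N \<in> inputs n \<Delta>.
           proper_edge_coloring (edges N) (\<lambda>(u, t). a (take (Suc t) N) u) \<and>
           (\<lambda>(u, t). a (take (Suc t) N) u) ` edges N \<subseteq> {..<q}"
proof -
  define ext where "ext = (\<lambda>(U :: nat \<Rightarrow> nat set) S f u. if u \<in> S then insert (f u) (U u) else U u)"
  define ok where "ok = (\<lambda>U S f. inj_on f S \<and> f ` S \<subseteq> {..<q} \<and> (\<forall>u\<in>S. f u \<notin> U u) \<and> Inv (ext U S f))"
  define F where "F = (\<lambda>U S. SOME f. ok U S f)"
  define used where "used = foldl (\<lambda>U S. ext U S (F U S)) (\<lambda>_. {})"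
  define a where "a = (\<lambda>N. F (used (butlast N)) (last N))"
  have F: "ok U S (F U S)" if "Inv U" "S \<subseteq> {..<n}" "card S \<le> \<Delta>" "\<And>u. u \<in> S \<Longrightarrow> card (U u) < \<Delta>" for U S
  proof -
    have "\<exists>f. ok U S f" unfolding ok_def ext_def using that by (intro step) auto
    then show ?thesis unfolding F_def by (rule someI_ex)
  qed
  have "proper_edge_coloring (edges N) (\<lambda>(u, t). a (take (Suc t) N) u) \<and>
        (\<lambda>(u, t). a (take (Suc t) N) u) ` edges N \<subseteq> {..<q}" if N: "N \<in> inputs n \<Delta>" for N
  proof -
    note bnd = inputs_bounds[OF N]
    define f where "f = (\<lambda>t. F (used (take t N)) (N ! t))"
    have a_eq: "a (take (Suc t) N) = f t" if "t < n" for t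
      using that bnd(1) by (simp add: a_def f_def take_Suc_conv_app_nth)
    have used_Suc: "used (take (Suc t) N) = ext (used (take t N)) (N ! t) (f t)" if "t < n" for t
      using that bnd(1) by (simp add: used_def f_def take_Suc_conv_app_nth)
    have deg: "card {s. s < t \<and> u \<in> N ! s} < \<Delta>" if "t < n" "u \<in> N ! t" for t u
    proof -
      have "card {s. s < t \<and> u \<in> N ! s} < card {s. s < n \<and> u \<in> N ! s}"
        using that by (intro psubset_card_mono) auto
      also have "\<dots> \<le> \<Delta>" using bnd that by blast
      finally show ?thesis .
    qed
    \<comment> \<open>Each earlier edge at \<open>u\<close> has added exactly one new color, so the
      degree bound yields the premise \<open>card (U u) < \<Delta>\<close> of
      \<open>step\<close>.\<close>
    have main: "Inv (used (take t N)) \<and> (\<forall>u. used (take t N) u = (\<lambda>s. f s u) ` {s. s < t \<and> u \<in> N ! s} \<and>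
       card (used (take t N) u) = card {s. s < t \<and> u \<in> N ! s})" if "t \<le> n" for t
      using that
    proof (induction t)
      case 0
      then show ?case using init by (simp add: used_def)
    next
      case (Suc t)
      then have t: "t < n" by simp
      from Suc.IH[OF less_imp_le_nat[OF t]] have IH: "Inv (used (take t N))"
        "\<And>u. used (take t N) u = (\<lambda>s. f s u) ` {s. s < t \<and> u \<in> N ! s}"
        "\<And>u. card (used (take t N) u) = card {s. s < t \<and> u \<in> N ! s}" by blast+
      have ok: "ok (used (take t N)) (N ! t) (f t)"
        unfolding f_def using bnd t by (intro F IH(1)) (auto simp: IH(3) deg)
      have eq: "{s. s < Suc t \<and> u \<in> N ! s} = (if u \<in> N ! t then insert t {s. s < t \<and> u \<in> N ! s} else {s. s < t \<and> u \<in> N ! s})" for u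
        by (auto simp: less_Suc_eq)
      show ?case
      proof (intro conjI allI)
        show "Inv (used (take (Suc t) N))" using ok used_Suc[OF t] by (simp add: ok_def)
        show "used (take (Suc t) N) u = (\<lambda>s. f s u) ` {s. s < Suc t \<and> u \<in> N ! s}" for u
          using IH(2)[of u] by (simp add: used_Suc[OF t] ext_def eq)
        have "f t u \<notin> used (take t N) u" if "u \<in> N ! t" for u using ok that by (simp add: ok_def)
        moreover have "finite (used (take t N) u)" for u by (simp add: IH(2))
        ultimately show "card (used (take (Suc t) N) u) = card {s. s < Suc t \<and> u \<in> N ! s}" for u
          by (simp add: used_Suc[OF t] ext_def eq IH(3))
      qed
    qed
    have ok: "ok (used (take t N)) (N ! t) (f t)" if t: "t < n" for t
    proof -
      have "Inv (used (take t N))" "\<And>u. card (used (take t N) u) = card {s. s < t \<and> u \<in> N ! s}"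
        using main[OF less_imp_le_nat[OF t]] by blast+
      then show ?thesis unfolding f_def using bnd t by (intro F) (auto simp: deg)
    qed
    have later: "f s u \<noteq> f t u" if "s < t" "t < n" "u \<in> N ! s" "u \<in> N ! t" for s t u
    proof -
      have "f s u \<in> used (take t N) u" using main[of t] that by auto
      moreover have "f t u \<notin> used (take t N) u" using ok[OF that(2)] that(4) by (simp add: ok_def)
      ultimately show ?thesis by metis
    qed
    have col: "(case e of (u, t) \<Rightarrow> a (take (Suc t) N) u) = f (snd e) (fst e)" if "e \<in> edges N" for e
      using that a_eq bnd(1) by (auto simp: edges_def)
    have "proper_edge_coloring (edges N) (\<lambda>(u, t). a (take (Suc t) N) u)"
      unfolding proper_edge_coloring_def
    proof (intro ballI impI)
      fix e e' assume e: "e \<in> edges N" "e' \<in> edges N" "e \<noteq> e' \<and> (fst e = fst e' \<or> snd e = snd e')"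
      obtain u t u' t' where et: "e = (u, t)" "e' = (u', t')" by (cases e, cases e')
      have in': "t < n" "u \<in> N ! t" "t' < n" "u' \<in> N ! t'" using e bnd(1) by (auto simp: et edges_def)
      have "f t u \<noteq> f t' u'"
      proof (cases "t = t'")
        case True
        then have "u \<noteq> u'" using e et by auto
        moreover have "inj_on (f t) (N ! t)" using ok[OF in'(1)] by (simp add: ok_def)
        ultimately show ?thesis using True in' by (auto simp: inj_on_def)
      next
        case False
        then have "u = u'" using e et by auto
        then show ?thesis using False in' later[of t t' u] later[of t' t u] by (cases "t < t'") auto
      qed
      then show "(case e of (u, t) \<Rightarrow> a (take (Suc t) N) u) \<noteq> (case e' of (u, t) \<Rightarrow> a (take (Suc t) N) u)"
        unfolding col[OF e(1)] col[OF e(2)] by (simp add: et)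
    qed
    moreover have "(\<lambda>(u, t). a (take (Suc t) N) u) ` edges N \<subseteq> {..<q}"
    proof
      fix y assume "y \<in> (\<lambda>(u, t). a (take (Suc t) N) u) ` edges N"
      then obtain e where e: "e \<in> edges N" "y = f (snd e) (fst e)" using col by auto
      then have "snd e < n" "fst e \<in> N ! snd e" using bnd(1) by (auto simp: edges_def)
      then show "y \<in> {..<q}" using ok[of "snd e"] e by (auto simp: ok_def)
    qed
    ultimately show ?thesis by blast
  qed
  then show ?thesis by blast
qed

section \<open>The algorithm and its competitive ratio\<close>

definition strategy :: "nat \<Rightarrow> nat \<Rightarrow> (arrivals \<Rightarrow> nat \<Rightarrow> nat) \<Rightarrow> bool" where
  "strategy n \<Delta> a \<longleftrightarrow> (\<forall>N \<in> inputs n \<Delta>.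
     proper_edge_coloring (edges N) (\<lambda>(u, t). a (take (Suc t) N) u) \<and>
     (\<lambda>(u, t). a (take (Suc t) N) u) ` edges N \<subseteq> {..<3 * \<Delta> div 2})"

lemma strategy_exists:
  assumes n: "n \<ge> 1" and \<Delta>: "real \<Delta> \<ge> 10 ^ 14 * (1 + ln (real n))"
  shows "\<exists>a. strategy n \<Delta> a"
proof -
  define k where "k = nat \<lceil>5 / 4 * real \<Delta>\<rceil>"
  define q where "q = 3 * \<Delta> div 2"
  define l :: real where "l = 1 / 10 ^ 10"
  have ln0: "ln (real n) \<ge> 0" using n by simp
  then have big: "real \<Delta> \<ge> 10 ^ 14" using \<Delta> by simp
  have k: "5 / 4 * real \<Delta> \<le> real k" "real k \<le> 5 / 4 * real \<Delta> + 1"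
    unfolding k_def by linarith+
  have q: "real q \<ge> 3 / 2 * real \<Delta> - 1" unfolding q_def by linarith
  have e4: "(4::real) \<le> exp 3" using exp_ge_add_one_self[of 3] by simp
  have "real (n\<^sup>2 + 3 * n) \<le> 4 * (real n)\<^sup>2"
  proof -
    have "n * 1 \<le> n * n" using n by (intro mult_left_mono) auto
    then have "n\<^sup>2 + 3 * n \<le> 4 * n\<^sup>2" by (simp add: power2_eq_square)
    then show ?thesis by (metis of_nat_le_iff of_nat_mult of_nat_numeral of_nat_power)
  qed
  also have "\<dots> \<le> exp 3 * (exp (ln (real n)))\<^sup>2" using e4 n by simp
  also have "\<dots> = exp (3 + 2 * ln (real n))" by (simp only: exp_add exp_double)
  also have "\<dots> \<le> exp (l * (real k / 2500) - (l * 1000)\<^sup>2 * (2 * real \<Delta>))"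
  proof -
    \<comment> \<open>For this \<open>l\<close> the first term is at least
      \<open>5 / 10 ^ 14 * \<Delta>\<close>, and the discount is
      \<open>2 / 10 ^ 14 * \<Delta>\<close>.\<close>
    have "l * (real k / 2500) - (l * 1000)\<^sup>2 * (2 * real \<Delta>) \<ge> 3 / 10 ^ 14 * real \<Delta>"
      using k by (simp add: l_def power2_eq_square)
    moreover have "3 / 10 ^ 14 * real \<Delta> \<ge> 3 * (1 + ln (real n))" using \<Delta> by simp
    ultimately show ?thesis using ln0 by simp
  qed
  finally have budget: "real (n\<^sup>2 + 3 * n) \<le> exp (l * (real k / 2500) - (l * 1000)\<^sup>2 * (2 * real \<Delta>))" .
  interpret palette n \<Delta> k q "real k * (1 + 1 / 2500)" l
  proof
    show "\<Delta> \<ge> 1000000" using big by simp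
    show "real k + real \<Delta> / 4 - 2 \<le> real q" using k q by linarith
  qed (use k budget in \<open>auto simp: l_def\<close>)
  show ?thesis
    unfolding strategy_def q_def[symmetric]
  proof (rule online_strategy[where Inv = "\<lambda>U. \<exists>M. admissible M U"])
    show "\<exists>M. admissible M (\<lambda>_. {})" using admissible_init by blast
    fix U S
    assume "\<exists>M. admissible M U" and S: "S \<subseteq> {..<n}" "card S \<le> \<Delta>" "\<And>u. u \<in> S \<Longrightarrow> card (U u) < \<Delta>"
    then obtain M where "admissible M U" by blast
    from admissible_step[OF this S]
    show "\<exists>f. inj_on f S \<and> f ` S \<subseteq> {..<q} \<and> (\<forall>u\<in>S. f u \<notin> U u) \<and>
            (\<exists>M. admissible M (\<lambda>u. if u \<in> S then insert (f u) (U u) else U u))" by blast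
  qed
qed

text \<open>Properness is demanded for all \<open>n\<close> and \<open>\<Delta>\<close>, even where
  no strategy exists; the fallback gives all edges distinct colors, \<open>length N\<close>
  identifying the online node.\<close>

definition algorithm :: online_algorithm where
  "algorithm n \<Delta> = (if \<exists>a. strategy n \<Delta> a then SOME a. strategy n \<Delta> a else (\<lambda>N u. u + n * length N))"

lemma algorithm_strategy:
  assumes "\<exists>a. strategy n \<Delta> a"
  shows "strategy n \<Delta> (algorithm n \<Delta>)"
  using someI_ex[OF assms] assms by (simp add: algorithm_def)

lemma edges_subset: "N \<in> inputs n \<Delta> \<Longrightarrow> edges N \<subseteq> {..<n} \<times> {..<n}"
  using inputs_bounds(1,2)[of N n \<Delta>] by (fastforce simp: edges_def)

lemma edges_imp_degree_pos:
  assumes "N \<in> inputs n \<Delta>" "edges N \<noteq> {}"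
  shows "\<Delta> > 0"
proof -
  note bnd = inputs_bounds[OF assms(1)]
  obtain u t where "t < n" "u \<in> N ! t" using assms(2) bnd(1) by (auto simp: edges_def)
  moreover from this have "finite (N ! t)" using bnd(2) finite_subset by blast
  ultimately have "card (N ! t) > 0" by (auto simp: card_gt_0_iff)
  then show ?thesis using bnd(3)[OF \<open>t < n\<close>] by linarith
qed

lemma algorithm_proper: "online_edge_coloring_algorithm algorithm"
  unfolding online_edge_coloring_algorithm_def
proof (intro allI ballI)
  fix n \<Delta> N assume N: "N \<in> inputs n \<Delta>"
  show "proper_edge_coloring (edges N) (coloring_of algorithm n \<Delta> N)"
  proof (cases "\<exists>a. strategy n \<Delta> a")
    case True
    then show ?thesis using algorithm_strategy[OF True] N by (simp add: strategy_def coloring_of_def)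
  next
    case False
    have "e = e'" if "e \<in> edges N" "e' \<in> edges N"
      and "coloring_of algorithm n \<Delta> N e = coloring_of algorithm n \<Delta> N e'" for e e'
    proof -
      obtain u t u' t' where et: "e = (u, t)" "e' = (u', t')" by (cases e, cases e')
      have b: "u < n" "u' < n" "t < n" "t' < n" using edges_subset[OF N] that et by auto
      have eq: "u + n * Suc t = u' + n * Suc t'"
        using that(3) b False inputs_bounds(1)[OF N] by (simp add: et coloring_of_def algorithm_def)
      have "(u + n * Suc t) mod n = u" "(u' + n * Suc t') mod n = u'" using b by (simp_all only: mod_mult_self2 mod_less)
      then have "u = u'" using eq by metis
      then show ?thesis using eq b by (simp add: et)
    qed
    then show ?thesis unfolding proper_edge_coloring_def by blast
  qed
qed

theorem theorem1p1:
  "\<exists>A. online_edge_coloring_algorithm A \<and>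
     (\<forall>\<Delta> :: nat \<Rightarrow> nat. (\<lambda>n. real (\<Delta> n)) \<in> \<omega>(\<lambda>n. ln (real n)) \<longrightarrow>
       (\<exists>\<epsilon> :: nat \<Rightarrow> real. \<epsilon> \<in> o(\<lambda>_. 1) \<and>
         (\<forall>n. competitive (exp 1 / (exp 1 - 1) + \<epsilon> n) A n (\<Delta> n))))"
proof (intro exI[of _ algorithm] conjI algorithm_proper allI impI)
  fix \<Delta> :: "nat \<Rightarrow> nat" assume "(\<lambda>n. real (\<Delta> n)) \<in> \<omega>(\<lambda>n. ln (real n))"
  from landau_omega.smallD[OF this, of "2 * 10 ^ 14"]
  have "eventually (\<lambda>n. norm (real (\<Delta> n)) \<ge> 2 * 10 ^ 14 * norm (ln (real n))) at_top" by simp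
  then obtain n0 where n0: "\<And>n. n \<ge> n0 \<Longrightarrow> real (\<Delta> n) \<ge> 2 * 10 ^ 14 * \<bar>ln (real n)\<bar>"
    by (auto simp: eventually_at_top_linorder)
  \<comment> \<open>From 3 on \<open>ln n \<ge> 1\<close>, so
    \<open>1 + ln n \<le> 2 * ln n\<close>, whence the factor 2 in the Landau constant.\<close>
  define n1 where "n1 = max n0 3"
  have strat: "\<exists>a. strategy n (\<Delta> n) a" if "n \<ge> n1" for n
  proof (rule strategy_exists)
    show "n \<ge> 1" using that by (simp add: n1_def)
    have "exp 1 \<le> real n" using that exp_le by (simp add: n1_def)
    then have "ln (real n) \<ge> 1" using \<open>n \<ge> 1\<close> by (subst ln_ge_iff) auto
    then show "real (\<Delta> n) \<ge> 10 ^ 14 * (1 + ln (real n))" using n0[of n] that by (simp add: n1_def)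
  qed
  \<comment> \<open>The finitely many small \<open>n\<close> are absorbed here: \<open>n * n\<close>
    bounds the number of edges, and a single edge forces \<open>\<Delta> n \<ge> 1\<close>.\<close>
  define \<epsilon> :: "nat \<Rightarrow> real" where "\<epsilon> = (\<lambda>n. if n < n1 then real (n * n) else 0)"
  \<comment> \<open>Equivalent to \<open>exp 1 \<le> 3\<close>, as \<open>exp 1 > 1\<close>.\<close>
  have ratio: "exp 1 / (exp 1 - 1) \<ge> (3 / 2 :: real)"
    using exp_le exp_ge_add_one_self[of 1] by (simp add: field_simps)
  have "eventually (\<lambda>n. \<epsilon> n = 0) at_top"
    using eventually_ge_at_top[of n1] by eventually_elim (simp add: \<epsilon>_def)
  then have "\<epsilon> \<in> o(\<lambda>_. 1)" by (subst landau_o.small.in_cong[where g = "\<lambda>_. 0"]) auto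
  moreover have "competitive (exp 1 / (exp 1 - 1) + \<epsilon> n) algorithm n (\<Delta> n)" for n
    unfolding competitive_def
  proof
    fix N assume N: "N \<in> inputs n (\<Delta> n)"
    let ?X = "coloring_of algorithm n (\<Delta> n) N ` edges N"
    have finE: "finite (edges N)" using edges_subset[OF N] finite_subset by blast
    show "real (card ?X) \<le> (exp 1 / (exp 1 - 1) + \<epsilon> n) * real (\<Delta> n)"
    proof (cases "n < n1")
      case True
      show ?thesis
      proof (cases "edges N = {}")
        case True
        then show ?thesis using ratio by (simp add: \<epsilon>_def)
      next
        case ne: False
        have pos: "0 \<le> exp 1 / (exp 1 - 1) + \<epsilon> n"
          using ratio by (intro add_nonneg_nonneg) (auto simp: \<epsilon>_def)
        have "card ?X \<le> card (edges N)" using finE by (rule card_image_le)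
        also have "\<dots> \<le> n * n" using card_mono[OF _ edges_subset[OF N]] by simp
        finally have "real (card ?X) \<le> real (n * n)" by (simp only: of_nat_le_iff)
        also have "\<dots> \<le> exp 1 / (exp 1 - 1) + \<epsilon> n" using True ratio by (simp add: \<epsilon>_def)
        also have "\<dots> \<le> (exp 1 / (exp 1 - 1) + \<epsilon> n) * real (\<Delta> n)"
          using mult_left_mono[of 1 "real (\<Delta> n)", OF _ pos] edges_imp_degree_pos[OF N ne] by simp
        finally show ?thesis .
      qed
    next
      case False
      then have "strategy n (\<Delta> n) (algorithm n (\<Delta> n))" by (intro algorithm_strategy strat) simp
      then have "?X \<subseteq> {..<3 * \<Delta> n div 2}" using N by (simp add: strategy_def coloring_of_def)
      from card_mono[OF _ this] have "real (card ?X) \<le> 3 / 2 * real (\<Delta> n)" by simp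
      also have "\<dots> \<le> (exp 1 / (exp 1 - 1) + \<epsilon> n) * real (\<Delta> n)"
        using ratio False by (intro mult_right_mono) (auto simp: \<epsilon>_def)
      finally show ?thesis .
    qed
  qed
  ultimately show "\<exists>\<epsilon>. \<epsilon> \<in> o(\<lambda>_. 1) \<and> (\<forall>n. competitive (exp 1 / (exp 1 - 1) + \<epsilon> n) algorithm n (\<Delta> n))"
    by blast
qed

end
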